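(* Consider the charged-particle equation $\ddot x=\dot x\times B(x)+E(x)$ in $\mathbb{R}^3$ with $B(x)=\frac1\varepsilon B_0+B_1(x)$, $|B_0|=1$, $0<\varepsilon\ll1$, where the fields have the form $$B_1(x)=B_1(x_\perp)+\varepsilon B_2(x),\qquad E(x)=E_\perp(x_\perp)+E_\parallel(x)+\varepsilon E_2(x),$$ with $E_\perp\cdot B_0=0$ and $E_\parallel\times B_0=0$, and where the functions $B_1,B_2,E_\perp,E_\parallel,E_2$ on the right-hand sides and all their derivatives are bounded independently of $\varepsilon$. Let $x(t)$ be a solution with initial velocity bounded independently of $\varepsilon$, $|\dot x(0)|\le M$, which stays in a compact set $K$ for $0\le t\le c\,\varepsilon^{-1}$ (with $K$ and $c$ independent of $\varepsilon$). Then the solution $y_\perp(t)$ of the initial value problem for the slow differential equation $$\dot y_\perp(t)=\varepsilon E_\perp(y_\perp(t))\times B_0,\qquad y_\perp(0)=x_\perp(0),$$ remains $O(\varepsilon)$-close to the perpendicular component of $x(t)$ over times $O(\varepsilon^{-1})$: $$|x_\perp(t)-y_\perp(t)|\le C\varepsilon,\qquad 0\le t\le c/\varepsilon .$$ The constant $C$ is independent of $\varepsilon$ and $t$ with $0\le t\le c/\varepsilon$, but depends on the initial velocity bound $M$, on bounds of derivatives of $B_1$ and $E$ on the compact set $K$, and on $c$.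
   Context: $B_0\in\mathbb{R}^3$ is a fixed unit vector. $P_\parallel=B_0B_0^\top$ is the orthogonal projection onto the span of $B_0$, $P_\perp=I-P_\parallel$, and $x\in\mathbb{R}^3$ is decomposed as $x=x_\parallel+x_\perp$ with $x_\parallel=P_\parallel x$, $x_\perp=P_\perp x$. The notation $B_1(x_\perp)$ on the right-hand side denotes (by slight abuse of notation) a function depending only on $x_\perp$. All fields are smooth. *)

theory Defs
  imports "HOL-Analysis.Analysis"
begin

section \<open>Projections along and orthogonal to a unit vector\<close>

definition P_par :: "real^3 \<Rightarrow> real^3 \<Rightarrow> real^3" where
  "P_par B0 x = (B0 \<bullet> x) *\<^sub>R B0"

definition P_perp :: "real^3 \<Rightarrow> real^3 \<Rightarrow> real^3" where
  "P_perp B0 x = x - P_par B0 x"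

text \<open>A field written $F(x_\perp)$ is a function on the whole space that only depends on the
  perpendicular component of its argument.\<close>

definition depends_on_perp :: "real^3 \<Rightarrow> (real^3 \<Rightarrow> real^3) \<Rightarrow> bool" where
  "depends_on_perp B0 F \<longleftrightarrow> (\<forall>x y. P_perp B0 x = P_perp B0 y \<longrightarrow> F x = F y)"


section \<open>Smooth fields and bounds on their derivatives\<close>

text \<open>\<open>iter_deriv F [u\<^sub>1, \<dots>, u\<^sub>n] x\<close> is the $n$-th derivative of \<open>F\<close> at \<open>x\<close>, a multilinear map,
  applied to the directions \<open>u\<^sub>1, \<dots>, u\<^sub>n\<close>.\<close>

fun iter_deriv :: "(real^3 \<Rightarrow> real^3) \<Rightarrow> (real^3) list \<Rightarrow> real^3 \<Rightarrow> real^3" where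
  "iter_deriv F [] = F"
| "iter_deriv F (u # us) = (\<lambda>x. frechet_derivative (iter_deriv F us) (at x) u)"

definition smooth_field :: "(real^3 \<Rightarrow> real^3) \<Rightarrow> bool" where
  "smooth_field F \<longleftrightarrow> (\<forall>us x. iter_deriv F us differentiable (at x))"

text \<open>Since the directions range over the unit sphere, the number \<open>\<beta>\<close> below bounds the operator norm
  of the $n$-th derivative as a multilinear map, at every point of \<open>S\<close>; \<open>n = 0\<close> bounds \<open>F\<close> itself.\<close>

definition deriv_bounded_on ::
    "(real^3) set \<Rightarrow> nat \<Rightarrow> real \<Rightarrow> (real^3 \<Rightarrow> real^3) \<Rightarrow> bool" where
  "deriv_bounded_on S n \<beta> F \<longleftrightarrow>
     (\<forall>x\<in>S. \<forall>us. length us = n \<and> (\<forall>u\<in>set us. norm u = 1) \<longrightarrow> norm (iter_deriv F us x) \<le> \<beta>)"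

text \<open>The fields may depend on $\varepsilon$, and are represented as families indexed by
  $\varepsilon \in (0,1]$. Each derivative is bounded on the whole space, with a bound that does not
  depend on $\varepsilon$.\<close>

definition smooth_bounded_family :: "(real \<Rightarrow> real^3 \<Rightarrow> real^3) \<Rightarrow> bool" where
  "smooth_bounded_family F \<longleftrightarrow>
     (\<forall>\<epsilon>\<in>{0<..1}. smooth_field (F \<epsilon>)) \<and>
     (\<forall>n. \<exists>\<beta>. \<forall>\<epsilon>\<in>{0<..1}. deriv_bounded_on UNIV n \<beta> (F \<epsilon>))"


section \<open>The electromagnetic fields\<close>

definition admissible_fields ::
    "real^3 \<Rightarrow> (real \<Rightarrow> real^3 \<Rightarrow> real^3) \<Rightarrow> (real \<Rightarrow> real^3 \<Rightarrow> real^3) \<Rightarrow>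
     (real \<Rightarrow> real^3 \<Rightarrow> real^3) \<Rightarrow> (real \<Rightarrow> real^3 \<Rightarrow> real^3) \<Rightarrow> (real \<Rightarrow> real^3 \<Rightarrow> real^3) \<Rightarrow> bool" where
  "admissible_fields B0 B1 B2 Eperp Epar E2 \<longleftrightarrow>
     smooth_bounded_family B1 \<and> smooth_bounded_family B2 \<and>
     smooth_bounded_family Eperp \<and> smooth_bounded_family Epar \<and> smooth_bounded_family E2 \<and>
     (\<forall>\<epsilon>\<in>{0<..1}. depends_on_perp B0 (B1 \<epsilon>) \<and> depends_on_perp B0 (Eperp \<epsilon>) \<and>
        (\<forall>x. Eperp \<epsilon> x \<bullet> B0 = 0) \<and> (\<forall>x. cross3 (Epar \<epsilon> x) B0 = 0))"

definition magnetic_field ::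
    "real^3 \<Rightarrow> (real \<Rightarrow> real^3 \<Rightarrow> real^3) \<Rightarrow> (real \<Rightarrow> real^3 \<Rightarrow> real^3) \<Rightarrow> real \<Rightarrow> real^3 \<Rightarrow> real^3" where
  "magnetic_field B0 B1 B2 \<epsilon> x =
     (1 / \<epsilon>) *\<^sub>R B0 + (B1 \<epsilon> (P_perp B0 x) + \<epsilon> *\<^sub>R B2 \<epsilon> x)"

definition electric_field ::
    "real^3 \<Rightarrow> (real \<Rightarrow> real^3 \<Rightarrow> real^3) \<Rightarrow> (real \<Rightarrow> real^3 \<Rightarrow> real^3) \<Rightarrow> (real \<Rightarrow> real^3 \<Rightarrow> real^3) \<Rightarrow>
     real \<Rightarrow> real^3 \<Rightarrow> real^3" where
  "electric_field B0 Eperp Epar E2 \<epsilon> x =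
     Eperp \<epsilon> (P_perp B0 x) + Epar \<epsilon> x + \<epsilon> *\<^sub>R E2 \<epsilon> x"


section \<open>The differential equations\<close>

text \<open>\<open>x\<close> is the position and \<open>v\<close> the velocity; derivatives at the end points of the time interval
  are one-sided.\<close>

definition charged_particle_solution ::
    "(real^3 \<Rightarrow> real^3) \<Rightarrow> (real^3 \<Rightarrow> real^3) \<Rightarrow> real \<Rightarrow> (real \<Rightarrow> real^3) \<Rightarrow> (real \<Rightarrow> real^3) \<Rightarrow> bool" where
  "charged_particle_solution B E T x v \<longleftrightarrow>
     (\<forall>t\<in>{0..T}. (x has_vector_derivative v t) (at t within {0..T}) \<and>
        (v has_vector_derivative (cross3 (v t) (B (x t)) + E (x t))) (at t within {0..T}))"

definition slow_solution ::
    "real^3 \<Rightarrow> (real^3 \<Rightarrow> real^3) \<Rightarrow> real \<Rightarrow> real \<Rightarrow> real^3 \<Rightarrow> (real \<Rightarrow> real^3) \<Rightarrow> bool" where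
  "slow_solution B0 Ep \<epsilon> T y0 y \<longleftrightarrow>
     y 0 = y0 \<and>
     (\<forall>t\<in>{0..T}. (y has_vector_derivative (\<epsilon> *\<^sub>R cross3 (Ep (y t)) B0)) (at t within {0..T}))"

end

theory Submission
  imports Defs
begin

text \<open>Write \<open>J = B\<^sub>0 \<times> v\<close> and let \<open>q = x - \<epsilon> J\<close> be the guiding centre. Since \<open>\<epsilon> J' = v\<^sub>\<perp> + O(\<epsilon>)\<close>, a term
  linear in \<open>v\<^sub>\<perp>\<close> whose coefficient varies with speed \<open>O(\<epsilon>)\<close> is a total derivative up to \<open>O(\<epsilon>)\<close>, and
  \<open>B\<^sub>1\<close>, \<open>E\<^sub>\<perp>\<close> at \<open>q\<close> are such coefficients. Applied to \<open>B\<^sub>0 \<bullet> v\<close> this bounds the parallel velocity,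
  because confinement to \<open>K\<close> makes it bounded once in every unit of time; applied to \<open>|v\<^sub>\<perp>|\<^sup>2\<close> it gives an
  adiabatic invariant that controls the perpendicular velocity up to time \<open>c/\<epsilon>\<close>. A corrected
  guiding centre \<open>z\<close>, with \<open>|z - x\<^sub>\<perp>| = O(\<epsilon>)\<close>, then satisfies \<open>z' = \<epsilon> E\<^sub>\<perp>(x\<^sub>\<perp>) \<times> B\<^sub>0 + O(\<epsilon>\<^sup>2)\<close>, and
  Gronwall's inequality compares it with \<open>y\<close>. This is done twice: with the global Lipschitz
  constant of \<open>E\<^sub>\<perp>\<close>, which shows that \<open>y\<close> is close to \<open>K\<close> (up to \<open>B\<^sub>0\<close>-translation) for small \<open>\<epsilon>\<close>, and then
  with the constant \<open>b 1\<close> of \<open>K\<close> enlarged by 1, so that \<open>C\<close> only depends on the bounds on \<open>K\<close>.\<close>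

section \<open>Norm bounds and derivatives of cross and inner products\<close>

lemma norm_cross3_le: "norm (cross3 x y) \<le> norm x * norm y"
proof (rule power2_le_imp_le)
  show "(norm (cross3 x y))\<^sup>2 \<le> (norm x * norm y)\<^sup>2"
    unfolding norm_cross_dot[symmetric] by simp
qed simp

lemma norm_cross3_bound: "norm x \<le> a \<Longrightarrow> norm y \<le> b \<Longrightarrow> norm (cross3 x y) \<le> a * b"
  by (rule order_trans[OF norm_cross3_le]) (simp add: mult_mono' order_trans[OF norm_ge_zero])

lemma abs_inner_bound: "norm x \<le> a \<Longrightarrow> norm y \<le> b \<Longrightarrow> \<bar>x \<bullet> y\<bar> \<le> a * b"
  by (rule order_trans[OF Cauchy_Schwarz_ineq2]) (simp add: mult_mono' order_trans[OF norm_ge_zero])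

lemma norm_scaleR_bound: "\<bar>k\<bar> \<le> a \<Longrightarrow> norm y \<le> b \<Longrightarrow> norm (k *\<^sub>R y) \<le> a * b"
  by (simp add: mult_mono' order_trans[OF abs_ge_zero])

lemma bounded_bilinear_cross3: "bounded_bilinear cross3"
  by (rule bilinear_conv_bounded_bilinear[THEN iffD1, OF bilinear_cross])

lemma has_vector_derivative_cross3:
  assumes "(f has_vector_derivative f') (at t within S)" "(g has_vector_derivative g') (at t within S)"
  shows "((\<lambda>s. cross3 (f s) (g s)) has_vector_derivative (cross3 (f t) g' + cross3 f' (g t))) (at t within S)"
  by (rule bounded_bilinear.has_vector_derivative[OF bounded_bilinear_cross3 assms])

lemma has_vector_derivative_inner:
  assumes "(f has_vector_derivative f') (at t within S)" "(g has_vector_derivative g') (at t within S)"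
  shows "((\<lambda>s. f s \<bullet> g s) has_vector_derivative (f t \<bullet> g' + f' \<bullet> g t)) (at t within S)"
  by (rule bounded_bilinear.has_vector_derivative[OF bounded_bilinear_inner assms])

section \<open>Gronwall inequalities and a continuity argument\<close>

lemma gronwall_affine:
  fixes \<phi> \<phi>' :: "real \<Rightarrow> real"
  assumes d: "\<And>t. t \<in> {0..T} \<Longrightarrow> (\<phi> has_vector_derivative \<phi>' t) (at t within {0..T})"
    and le: "\<And>t. t \<in> {0..T} \<Longrightarrow> \<phi>' t \<le> a * (\<phi> t + k)"
    and t: "t \<in> {0..T}"
  shows "\<phi> t + k \<le> (\<phi> 0 + k) * exp (a * t)"
proof -
  \<comment> \<open>The differential inequality makes the derivative of \<open>?\<psi>\<close>
    nonpositive, and the mean value theorem then compares its values at \<open>t\<close> and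
    0.\<close>
  let ?\<psi> = "\<lambda>s. (\<phi> s + k) * exp (- (a * s))"
  have D: "(?\<psi> has_real_derivative (\<phi>' s - a * (\<phi> s + k)) * exp (- (a * s))) (at s within {0..t})"
    if "s \<in> {0..t}" for s
  proof -
    have *: "(\<phi> has_real_derivative \<phi>' s) (at s within {0..t})"
      unfolding has_real_derivative_iff_has_vector_derivative
      by (rule has_vector_derivative_within_subset[OF d]) (use that t in auto)
    show ?thesis
      by (rule derivative_eq_intros * refl | simp)+ (simp add: algebra_simps)
  qed
  have "\<exists>s\<in>{0..t}. ?\<psi> t - ?\<psi> 0 = (\<phi>' s - a * (\<phi> s + k)) * exp (- (a * s)) * (t - 0)"
    by (rule mvt_very_simple) (use t D in \<open>auto simp: has_field_derivative_def\<close>)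
  then obtain s where s: "s \<in> {0..t}"
    "?\<psi> t - ?\<psi> 0 = (\<phi>' s - a * (\<phi> s + k)) * exp (- (a * s)) * (t - 0)" by blast
  have "(\<phi>' s - a * (\<phi> s + k)) * exp (- (a * s)) * (t - 0) \<le> 0"
    using le[of s] s(1) t by (intro mult_nonpos_nonneg) auto
  then have "?\<psi> t \<le> \<phi> 0 + k" using s(2) by simp
  then show ?thesis
    by (simp add: exp_minus field_simps)
qed

text \<open>The norm is squared so that the scalar inequality applies without
  differentiating the norm at \<open>0\<close>.\<close>

lemma gronwall_norm:
  fixes e e' :: "real \<Rightarrow> 'a::real_inner"
  assumes d: "\<And>t. t \<in> {0..T} \<Longrightarrow> (e has_vector_derivative e' t) (at t within {0..T})"
    and le: "\<And>t. t \<in> {0..T} \<Longrightarrow> norm (e' t) \<le> a * (norm (e t) + b)"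
    and t: "t \<in> {0..T}" and a: "a \<ge> 0" 
  shows "(norm (e t))\<^sup>2 + b\<^sup>2 \<le> ((norm (e 0))\<^sup>2 + b\<^sup>2) * exp (3 * a * t)"
proof -
  let ?\<phi> = "\<lambda>s. e s \<bullet> e s"
  have D: "(?\<phi> has_vector_derivative (e s \<bullet> e' s + e' s \<bullet> e s)) (at s within {0..T})" if "s \<in> {0..T}" for s
    by (rule has_vector_derivative_inner d that)+
  have B: "e s \<bullet> e' s + e' s \<bullet> e s \<le> (3 * a) * (?\<phi> s + b\<^sup>2)" if "s \<in> {0..T}" for s
  proof -
    have "e s \<bullet> e' s \<le> norm (e s) * norm (e' s)" by (rule norm_cauchy_schwarz)
    also have "\<dots> \<le> norm (e s) * (a * (norm (e s) + b))"
      by (intro mult_left_mono le that) simp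
    also have "\<dots> = a * ((norm (e s))\<^sup>2 + norm (e s) * b)" by (simp add: power2_eq_square algebra_simps)
    \<comment> \<open>Young's inequality on \<open>norm (e s) * b\<close> gives the factor 3/2; the
      two equal inner products in the derivative double it to the rate \<open>3 * a\<close>.\<close>
    also have "\<dots> \<le> a * ((3/2) * ((norm (e s))\<^sup>2 + b\<^sup>2))"
    proof (rule mult_left_mono[OF _ a])
      have "0 \<le> (norm (e s) - b)\<^sup>2" by simp
      then have "2 * (norm (e s) * b) \<le> (norm (e s))\<^sup>2 + b\<^sup>2" by (simp add: power2_diff)
      then show "(norm (e s))\<^sup>2 + norm (e s) * b \<le> 3/2 * ((norm (e s))\<^sup>2 + b\<^sup>2)"
        using zero_le_power2[of b] by argo
    qed
    finally show ?thesis by (simp add: inner_commute power2_norm_eq_inner algebra_simps)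
  qed
  show ?thesis
    using gronwall_affine[OF D B t] by (simp add: power2_norm_eq_inner)
qed

text \<open>At the first time where \<open>\<phi>\<close> reaches \<open>R\<close>, the bound
  \<open>\<phi> \<le> R\<close> holds on the whole interval up to it, so \<open>step\<close>
  contradicts the choice of that time. This turns an a priori bound on the velocity into a proved
  one.\<close>

lemma continuous_bootstrap:
  fixes \<phi> :: "real \<Rightarrow> real"
  assumes cont: "continuous_on {0..T} \<phi>" and init: "\<phi> 0 < R"
    and step: "\<And>S. S \<in> {0..T} \<Longrightarrow> (\<And>t. t \<in> {0..S} \<Longrightarrow> \<phi> t \<le> R) \<Longrightarrow> \<phi> S < R"
    and t: "t \<in> {0..T}"
  shows "\<phi> t < R"
proof (rule ccontr)
  assume "\<not> \<phi> t < R"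
  let ?A = "{s \<in> {0..T}. R \<le> \<phi> s}"
  have "closed ?A"
    by (intro continuous_on_closed_Collect_le continuous_on_const cont closed_atLeastAtMost)
  then have cp: "compact ?A" by (intro compact_eq_bounded_closed[THEN iffD2] conjI)
     (auto intro: bounded_subset[of "{0..T}"])
  have "?A \<noteq> {}" using t \<open>\<not> \<phi> t < R\<close> by auto
  then obtain s where s: "s \<in> ?A" "\<And>r. r \<in> ?A \<Longrightarrow> s \<le> r"
    using compact_attains_inf[OF cp] by blast
  \<comment> \<open>The intermediate value theorem shows that the value at the first time is exactly
    \<open>R\<close>, so the non-strict bound required by \<open>step\<close> also holds at the end
    point.\<close>
  have "\<exists>r. 0 \<le> r \<and> r \<le> s \<and> \<phi> r = R"
    by (rule IVT') (use s init cont in \<open>auto intro: continuous_on_subset\<close>)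
  then obtain r where r: "0 \<le> r" "r \<le> s" "\<phi> r = R" by blast
  then have "r \<in> ?A" using s by auto
  then have "r = s" using s(2) r by fastforce
  have "\<phi> s < R"
  proof (rule step)
    show "\<phi> q \<le> R" if "q \<in> {0..s}" for q
      using s(2)[of q] s(1) that r(3) \<open>r = s\<close> by (cases "q = s") fastforce+
  qed (use s in auto)
  then show False using s by auto
qed

section \<open>The perpendicular projection and fields depending only on it\<close>

lemma P_perp_add: "P_perp B0 (x + y) = P_perp B0 x + P_perp B0 y"
  by (simp add: P_perp_def P_par_def algebra_simps)

lemma P_perp_diff: "P_perp B0 (x - y) = P_perp B0 x - P_perp B0 y"
  by (simp add: P_perp_def P_par_def algebra_simps)

lemma P_perp_idem: "norm B0 = 1 \<Longrightarrow> P_perp B0 (P_perp B0 x) = P_perp B0 x"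
  by (simp add: P_perp_def P_par_def algebra_simps norm_eq_1)

lemma bounded_linear_P_perp: "bounded_linear (P_perp B0)"
  unfolding P_perp_def P_par_def by (intro bounded_linear_intros)

lemma cross3_cross3_unit: "norm B0 = 1 \<Longrightarrow> cross3 B0 (cross3 x B0) = P_perp B0 x"
  by (simp add: Lagrange P_perp_def P_par_def norm_eq_1)

text \<open>\<open>F\<close> equals its composition with the affine projection \<open>?k\<close>
  onto the plane through \<open>p\<close> orthogonal to \<open>B0\<close>; the chain rule and
  uniqueness of the derivative do the rest.\<close>

lemma depends_on_perp_derivative:
  assumes dep: "depends_on_perp B0 F" and n: "norm B0 = 1" and D: "(F has_derivative D) (at p)"
  shows "D h = D (P_perp B0 h)"
proof -
  let ?k = "\<lambda>y. p + P_perp B0 (y - p)"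
  have "F (?k y) = F y" for y
    using dep n unfolding depends_on_perp_def
    by (metis (no_types, lifting) P_perp_add P_perp_idem P_perp_diff diff_add_cancel add.commute)
  moreover have "(F \<circ> ?k has_derivative D \<circ> (\<lambda>y. P_perp B0 y)) (at p)"
  proof (rule diff_chain_at)
    show "(?k has_derivative P_perp B0) (at p)"
      by (rule derivative_eq_intros bounded_linear.has_derivative[OF bounded_linear_P_perp] refl | simp)+
    show "(F has_derivative D) (at (?k p))" using D by (simp add: P_perp_def P_par_def)
  qed
  ultimately have "(F has_derivative D \<circ> (\<lambda>y. P_perp B0 y)) (at p)"
    by (simp add: o_def)
  from has_derivative_unique[OF D this] show ?thesis by (simp add: fun_eq_iff)
qed

section \<open>Derivative bounds and Lipschitz constants\<close>

lemma smooth_field_has_derivative: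
  assumes "smooth_field F"
  shows "(iter_deriv F us has_derivative (\<lambda>h. iter_deriv F (h # us) x)) (at x)"
  using assms unfolding smooth_field_def by (simp add: frechet_derivative_works[symmetric])

text \<open>Linearity in the outermost direction rescales the bound from unit vectors to any
  \<open>h\<close>, while the directions in \<open>us\<close> stay unit vectors.\<close>

lemma norm_iter_deriv_le:
  assumes F: "smooth_field F" and b: "deriv_bounded_on S (Suc (length us)) \<beta> F" and "x \<in> S"
    and us: "\<And>u. u \<in> set us \<Longrightarrow> norm u = 1"
  shows "norm (iter_deriv F (h # us) x) \<le> \<beta> * norm h"
proof (cases "h = 0")
  case True
  then show ?thesis
    using bounded_linear.linear[OF has_derivative_bounded_linear[OF smooth_field_has_derivative[OF F]], of us x]
    by (simp add: linear_0)
next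
  case False
  let ?D = "\<lambda>h. iter_deriv F (h # us) x"
  have lin: "linear ?D"
    using bounded_linear.linear[OF has_derivative_bounded_linear[OF smooth_field_has_derivative[OF F]]] .
  have "?D h = ?D (norm h *\<^sub>R sgn h)" using False by (simp add: sgn_div_norm)
  also have "\<dots> = norm h *\<^sub>R ?D (sgn h)" using linear_cmul[OF lin] .
  finally have "norm (?D h) = norm h * norm (?D (sgn h))" by simp
  moreover have "norm (?D (sgn h)) \<le> \<beta>"
    using b \<open>x \<in> S\<close> us False unfolding deriv_bounded_on_def
    by (metis (no_types, lifting) insert_iff length_Cons list.simps(15) norm_sgn)
  ultimately show ?thesis by (metis mult.commute mult_left_mono norm_ge_zero)
qed

text \<open>Mean value inequality with the derivative bound on the whole space. The resulting
  \<open>L\<close> is not controlled by data on \<open>K\<close>, so it may influence the threshold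
  for \<epsilon> but not the final constant.\<close>

lemma smooth_bounded_family_lipschitz:
  assumes "smooth_bounded_family F"
  obtains L where "L \<ge> 1" "\<And>\<epsilon> x y. \<epsilon> \<in> {0<..1} \<Longrightarrow> norm (F \<epsilon> x - F \<epsilon> y) \<le> L * norm (x - y)"
proof -
  from assms obtain \<beta> where sm: "\<And>\<epsilon>. \<epsilon> \<in> {0<..1} \<Longrightarrow> smooth_field (F \<epsilon>)"
    and b: "\<And>\<epsilon>. \<epsilon> \<in> {0<..1} \<Longrightarrow> deriv_bounded_on UNIV (Suc 0) \<beta> (F \<epsilon>)"
    unfolding smooth_bounded_family_def by meson
  show thesis
  proof (rule that[of "max 1 \<beta>"])
    fix \<epsilon> :: real and x y :: "real^3" assume e: "\<epsilon> \<in> {0<..1}"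
    have "norm (F \<epsilon> x - F \<epsilon> y) \<le> max 1 \<beta> * norm (x - y)"
    proof (rule differentiable_bound[of UNIV "F \<epsilon>" "\<lambda>x h. iter_deriv (F \<epsilon>) [h] x"])
      show "(F \<epsilon> has_derivative (\<lambda>h. iter_deriv (F \<epsilon>) [h] p)) (at p within UNIV)" for p
        using smooth_field_has_derivative[OF sm[OF e], of "[]" p] by simp
      show "onorm (\<lambda>h. iter_deriv (F \<epsilon>) [h] p) \<le> max 1 \<beta>" for p
      proof (rule onorm_le)
        fix h
        have "norm (iter_deriv (F \<epsilon>) [h] p) \<le> \<beta> * norm h"
          by (rule norm_iter_deriv_le[OF sm[OF e]]) (use b[OF e] in auto)
        also have "\<dots> \<le> max 1 \<beta> * norm h" by (intro mult_right_mono) auto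
        finally show "norm (iter_deriv (F \<epsilon>) [h] p) \<le> max 1 \<beta> * norm h" .
      qed
    qed auto
    then show "norm (F \<epsilon> x - F \<epsilon> y) \<le> max 1 \<beta> * norm (x - y)" .
  qed auto
qed

text \<open>The global bound on the second derivative only determines \<open>\<delta>\<close>, not the bound itself.\<close>

lemma smooth_bounded_family_near:
  assumes F: "smooth_bounded_family F"
    and K: "\<And>\<epsilon>. \<epsilon> \<in> {0<..1} \<Longrightarrow> deriv_bounded_on K 1 b (F \<epsilon>)"
  obtains \<delta> where "\<delta> > 0"
    "\<And>\<epsilon> x p h. \<epsilon> \<in> {0<..1} \<Longrightarrow> x \<in> K \<Longrightarrow> norm (p - x) \<le> \<delta> \<Longrightarrow>
       norm (iter_deriv (F \<epsilon>) [h] p) \<le> (\<bar>b\<bar> + 1) * norm h"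
proof -
  from F obtain \<beta> where sm: "\<And>\<epsilon>. \<epsilon> \<in> {0<..1} \<Longrightarrow> smooth_field (F \<epsilon>)"
    and b: "\<And>\<epsilon>. \<epsilon> \<in> {0<..1} \<Longrightarrow> deriv_bounded_on UNIV (Suc (Suc 0)) \<beta> (F \<epsilon>)"
    unfolding smooth_bounded_family_def by meson
  show thesis
  \<comment> \<open>On a ball of this radius the second derivative bound lets the first derivative
    vary by at most 1, which is the \<open>+ 1\<close> in the conclusion.\<close>
  proof (rule that[of "1 / (\<bar>\<beta>\<bar> + 1)"])
    fix \<epsilon> :: real and x p h :: "real^3"
    assume e: "\<epsilon> \<in> {0<..1}" and x: "x \<in> K" and p: "norm (p - x) \<le> 1 / (\<bar>\<beta>\<bar> + 1)"
    have unit: "norm (iter_deriv (F \<epsilon>) [k] p) \<le> \<bar>b\<bar> + 1" if k: "norm k = 1" for k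
    proof -
      have "norm (iter_deriv (F \<epsilon>) [k] p - iter_deriv (F \<epsilon>) [k] x) \<le> \<bar>\<beta>\<bar> * norm (p - x)"
      proof (rule differentiable_bound[of UNIV _ "\<lambda>x h. iter_deriv (F \<epsilon>) [h, k] x"])
        show "(iter_deriv (F \<epsilon>) [k] has_derivative (\<lambda>h. iter_deriv (F \<epsilon>) [h,k] q)) (at q within UNIV)" for q
          using smooth_field_has_derivative[OF sm[OF e], of "[k]" q] by simp
        show "onorm (\<lambda>h. iter_deriv (F \<epsilon>) [h,k] q) \<le> \<bar>\<beta>\<bar>" for q
        proof (rule onorm_le)
          fix h
          have "norm (iter_deriv (F \<epsilon>) [h,k] q) \<le> \<beta> * norm h"
            by (rule norm_iter_deriv_le[OF sm[OF e]]) (use b[OF e] k in auto)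
          also have "\<dots> \<le> \<bar>\<beta>\<bar> * norm h" by (intro mult_right_mono) auto
          finally show "norm (iter_deriv (F \<epsilon>) [h,k] q) \<le> \<bar>\<beta>\<bar> * norm h" .
        qed
      qed auto
      also have "\<dots> \<le> (\<bar>\<beta>\<bar> + 1) * (1 / (\<bar>\<beta>\<bar> + 1))"
        by (intro mult_mono p) auto
      also have "\<dots> = 1" by (simp add: add_nonneg_eq_0_iff)
      finally have 1: "norm (iter_deriv (F \<epsilon>) [k] p - iter_deriv (F \<epsilon>) [k] x) \<le> 1" .
      have "norm (iter_deriv (F \<epsilon>) [k] x) \<le> b * norm k"
        by (rule norm_iter_deriv_le[OF sm[OF e] _ x]) (use K[OF e] in auto)
      with 1 k show ?thesis
        using norm_triangle_sub[of "iter_deriv (F \<epsilon>) [k] p" "iter_deriv (F \<epsilon>) [k] x"] by simp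
    qed
    have "norm (iter_deriv (F \<epsilon>) (h # []) p) \<le> (\<bar>b\<bar> + 1) * norm h"
      by (rule norm_iter_deriv_le[where S = "{p}", OF sm[OF e]])
        (auto simp: deriv_bounded_on_def length_Suc_conv intro!: unit[simplified])
    then show "norm (iter_deriv (F \<epsilon>) [h] p) \<le> (\<bar>b\<bar> + 1) * norm h" .
  qed (auto simp: add_nonneg_pos)
qed

text \<open>A ball is convex and contains its centre and \<open>p\<close>, so the mean value
  inequality works with a derivative bound known only near \<open>x\<close>.\<close>

lemma lipschitz_from_near_bound:
  assumes sm: "smooth_field F"
    and b: "\<And>p h. norm (p - x) \<le> \<delta> \<Longrightarrow> norm (iter_deriv F [h] p) \<le> L * norm h"
    and p: "norm (p - x) \<le> \<delta>"
  shows "norm (F p - F x) \<le> L * norm (p - x)"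
proof (rule differentiable_bound[of "cball x \<delta>" "F" "\<lambda>x h. iter_deriv F [h] x"])
  show "(F has_derivative (\<lambda>h. iter_deriv F [h] q)) (at q within cball x \<delta>)" for q
    using has_derivative_at_withinI[OF smooth_field_has_derivative[OF sm, of "[]" q]] by simp
  show "onorm (\<lambda>h. iter_deriv F [h] q) \<le> L" if "q \<in> cball x \<delta>" for q
    by (rule onorm_le) (use that in \<open>auto intro!: b simp del: iter_deriv.simps simp: dist_norm norm_minus_commute\<close>)
  show "x \<in> cball x \<delta>" using order_trans[OF norm_ge_zero p] by simp
qed (use p in \<open>auto simp: dist_norm norm_minus_commute\<close>)

section \<open>Gyration along a trajectory\<close>

text \<open>Only time dependence is left: \<open>B1 t\<close>, \<open>Ep t\<close>, \<dots> are the fields along the trajectory, and \<open>g t\<close>,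
  \<open>f t\<close> stand for \<open>B\<^sub>1\<close>, \<open>E\<^sub>\<perp>\<close> at the guiding centre \<open>x - \<epsilon> B\<^sub>0 \<times> v\<close>, which drifts with velocity
  \<open>O(\<epsilon>)\<close> in the perpendicular directions.\<close>

locale gyration =
  fixes B0 :: "real^3" and \<epsilon> \<beta> R r T :: real and x v g g' f f' B1 B2 Ep Epa E2 :: "real \<Rightarrow> real^3"
  assumes B0: "norm B0 = 1" and \<epsilon>: "0 < \<epsilon>" "\<epsilon> \<le> 1" and \<beta>: "1 \<le> \<beta>" and R: "1 \<le> R" "\<epsilon> * R\<^sup>2 \<le> 1"
    and T: "0 \<le> T"
    and x': "\<And>t. t \<in> {0..T} \<Longrightarrow> (x has_vector_derivative v t) (at t within {0..T})"
    and v': "\<And>t. t \<in> {0..T} \<Longrightarrow> (v has_vector_derivative ((1/\<epsilon>) *\<^sub>R cross3 (v t) B0 +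
        (cross3 (v t) (B1 t + \<epsilon> *\<^sub>R B2 t) + (Ep t + Epa t + \<epsilon> *\<^sub>R E2 t)))) (at t within {0..T})"
    and g': "\<And>t. t \<in> {0..T} \<Longrightarrow> (g has_vector_derivative g' t) (at t within {0..T})"
    and f': "\<And>t. t \<in> {0..T} \<Longrightarrow> (f has_vector_derivative f' t) (at t within {0..T})"
    and x_le: "\<And>t. t \<in> {0..T} \<Longrightarrow> norm (x t) \<le> r"
    and v_le: "\<And>t. t \<in> {0..T} \<Longrightarrow> norm (v t) \<le> R"
    and field_le: "\<And>t. t \<in> {0..T} \<Longrightarrow> norm (B1 t) \<le> \<beta>" "\<And>t. t \<in> {0..T} \<Longrightarrow> norm (B2 t) \<le> \<beta>"
      "\<And>t. t \<in> {0..T} \<Longrightarrow> norm (Ep t) \<le> \<beta>" "\<And>t. t \<in> {0..T} \<Longrightarrow> norm (Epa t) \<le> \<beta>"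
      "\<And>t. t \<in> {0..T} \<Longrightarrow> norm (E2 t) \<le> \<beta>"
      "\<And>t. t \<in> {0..T} \<Longrightarrow> norm (g t) \<le> \<beta>" "\<And>t. t \<in> {0..T} \<Longrightarrow> norm (f t) \<le> \<beta>"
    and Epa: "\<And>t. t \<in> {0..T} \<Longrightarrow> cross3 (Epa t) B0 = 0"
    and B1_g: "\<And>t. t \<in> {0..T} \<Longrightarrow> norm (B1 t - g t) \<le> \<beta> * (\<epsilon> * norm (cross3 B0 (v t)))"
    and Ep_f: "\<And>t. t \<in> {0..T} \<Longrightarrow> norm (Ep t - f t) \<le> \<beta> * (\<epsilon> * norm (cross3 B0 (v t)))"
    and g'_le: "\<And>t. t \<in> {0..T} \<Longrightarrow> norm (g' t) \<le> \<beta> * (\<epsilon> * (1 + norm (v t)))"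
    and f'_le: "\<And>t. t \<in> {0..T} \<Longrightarrow> norm (f' t) \<le> \<beta> * (\<epsilon> * (1 + norm (v t)))"
begin

text \<open>The cross product with \<open>B0\<close> rotates the perpendicular velocity by a quarter
  turn, so \<open>u\<close> is the speed of gyration. The vector \<open>a\<close> is the
  acceleration without the stiff term of order \<open>1/\<epsilon>\<close>.\<close>

definition J :: "real \<Rightarrow> real^3" where "J t = cross3 B0 (v t)"
definition w :: "real \<Rightarrow> real" where "w t = B0 \<bullet> v t"
definition vp :: "real \<Rightarrow> real^3" where "vp t = P_perp B0 (v t)"
definition E :: "real \<Rightarrow> real^3" where "E t = Ep t + Epa t + \<epsilon> *\<^sub>R E2 t"
definition a :: "real \<Rightarrow> real^3" where "a t = cross3 (v t) (B1 t + \<epsilon> *\<^sub>R B2 t) + E t"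
definition u :: "real \<Rightarrow> real" where "u t = norm (J t)"

lemma r: "0 \<le> r" using x_le[of 0] T order_trans[OF norm_ge_zero] by simp

lemma v_split: "v t = vp t + w t *\<^sub>R B0"
  by (simp add: vp_def w_def P_perp_def P_par_def)

lemma B0_B0: "B0 \<bullet> B0 = 1" using B0 by (simp add: norm_eq_1)

lemma B0_J: "B0 \<bullet> J t = 0" by (simp add: J_def dot_cross_self)

lemma vp_J: "vp t = cross3 (J t) B0"
  by (simp add: vp_def J_def cross3_cross3_unit[OF B0, symmetric] cross_skew[of "cross3 B0 (v t)" B0])
    (simp add: cross_skew[of B0 "v t"])

lemma norm_vp: "norm (vp t) = u t"
proof -
  have "(norm (cross3 (J t) B0))\<^sup>2 = (u t)\<^sup>2"
    using norm_cross[of "J t" B0] by (simp add: B0 B0_J inner_commute u_def)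
  then show ?thesis unfolding vp_J by (simp add: u_def)
qed

lemma u_le_v: "u t \<le> norm (v t)"
  unfolding u_def J_def using norm_cross3_le[of B0 "v t"] B0 by simp

lemma B1_g_u: "t \<in> {0..T} \<Longrightarrow> norm (B1 t - g t) \<le> \<beta> * (\<epsilon> * u t)"
  using B1_g unfolding u_def J_def .

lemma Ep_f_u: "t \<in> {0..T} \<Longrightarrow> norm (Ep t - f t) \<le> \<beta> * (\<epsilon> * u t)"
  using Ep_f unfolding u_def J_def .

lemma u_nonneg: "0 \<le> u t" by (simp add: u_def)

lemma v_le_u_w: "norm (v t) \<le> u t + \<bar>w t\<bar>"
  by (subst v_split) (rule order_trans[OF norm_triangle_ineq], simp add: norm_vp B0)

text \<open>Here \<open>\<epsilon> * R\<^sup>2 \<le> 1\<close> enters: products of \<epsilon> with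
  at most two velocities are bounded by numbers, which keeps the a priori bound \<open>R\<close> out
  of the velocity estimates below.\<close>

lemma eps_v: assumes "t \<in> {0..T}"
  shows "\<epsilon> * norm (v t) \<le> 1" "\<epsilon> * u t \<le> 1" "\<epsilon> * (u t * u t) \<le> 1"
    "\<epsilon> * (1 + norm (v t)) \<le> 2"
proof -
  have R1: "norm (v t) * 1 \<le> R * R" by (intro mult_mono v_le assms) (use R in auto)
  have "\<epsilon> * (norm (v t) * 1) \<le> \<epsilon> * (R * R)" by (intro mult_left_mono R1) (use \<epsilon> in auto)
  then show "\<epsilon> * norm (v t) \<le> 1" using R by (simp add: power2_eq_square)
  then show "\<epsilon> * (1 + norm (v t)) \<le> 2" using \<epsilon> by (simp add: algebra_simps)
  show "\<epsilon> * u t \<le> 1" 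
    by (rule order_trans[OF mult_left_mono[OF u_le_v]]) (use \<epsilon> \<open>\<epsilon> * norm (v t) \<le> 1\<close> in auto)
  have "u t * norm (v t) \<le> R * R"
    by (intro mult_mono v_le assms order_trans[OF u_le_v]) (use R in auto)
  then have "\<epsilon> * (u t * norm (v t)) \<le> \<epsilon> * (R * R)" by (intro mult_left_mono) (use \<epsilon> in auto)
  then have e2: "\<epsilon> * (u t * norm (v t)) \<le> 1" using R by (simp add: power2_eq_square)
  have uu: "u t * u t \<le> u t * norm (v t)" by (intro mult_left_mono u_le_v u_nonneg)
  then have "\<epsilon> * (u t * u t) \<le> \<epsilon> * (u t * norm (v t))" by (rule mult_left_mono) (use \<epsilon> in auto)
  with e2 show "\<epsilon> * (u t * u t) \<le> 1" by simp
qed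

lemma norm_Btot: "t \<in> {0..T} \<Longrightarrow> norm (B1 t + \<epsilon> *\<^sub>R B2 t) \<le> 2 * \<beta>"
  using norm_triangle_ineq[of "B1 t" "\<epsilon> *\<^sub>R B2 t"] norm_scaleR_bound[of \<epsilon> 1 "B2 t" \<beta>] field_le[of t] \<epsilon>
  by auto

lemma norm_E: "t \<in> {0..T} \<Longrightarrow> norm (E t) \<le> 3 * \<beta>"
  unfolding E_def
  using norm_triangle_ineq[of "Ep t + Epa t" "\<epsilon> *\<^sub>R E2 t"] norm_triangle_ineq[of "Ep t" "Epa t"]
    norm_scaleR_bound[of \<epsilon> 1 "E2 t" \<beta>] field_le[of t] \<epsilon>
  by auto

lemma norm_a: assumes "t \<in> {0..T}" shows "norm (a t) \<le> 2 * \<beta> * norm (v t) + 3 * \<beta>"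
  unfolding a_def
  using norm_triangle_ineq[of "cross3 (v t) (B1 t + \<epsilon> *\<^sub>R B2 t)" "E t"] norm_E[OF assms]
    norm_cross3_bound[OF order_refl norm_Btot[OF assms], of "v t"]
  by (auto simp: algebra_simps)

lemma v'_a: "t \<in> {0..T} \<Longrightarrow> (v has_vector_derivative ((1/\<epsilon>) *\<^sub>R cross3 (v t) B0 + a t)) (at t within {0..T})"
  using v' unfolding a_def E_def by simp

definition J' :: "real \<Rightarrow> real^3" where "J' t = (1/\<epsilon>) *\<^sub>R vp t + cross3 B0 (a t)"

text \<open>Rotating twice reproduces the perpendicular velocity. Each averaging step below uses
  this to trade \<open>vp\<close> for a derivative.\<close>

lemma eps_J': "\<epsilon> *\<^sub>R J' t = vp t + \<epsilon> *\<^sub>R cross3 B0 (a t)"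
  unfolding J'_def using \<epsilon> by (simp add: algebra_simps)

lemma J_deriv: assumes "t \<in> {0..T}" shows "(J has_vector_derivative J' t) (at t within {0..T})"
proof -
  have "((\<lambda>s. cross3 B0 (v s)) has_vector_derivative
     (cross3 B0 ((1/\<epsilon>) *\<^sub>R cross3 (v t) B0 + a t) + cross3 0 (v t))) (at t within {0..T})"
    by (intro has_vector_derivative_cross3 v'_a assms has_vector_derivative_const)
  then show ?thesis
    unfolding J_def[abs_def] J'_def vp_def
    by (simp add: cross_add_right cross_mult_right cross3_cross3_unit[OF B0])
qed

section \<open>Bound on the parallel velocity\<close>

lemma w_deriv: assumes "t \<in> {0..T}" shows "(w has_vector_derivative (B0 \<bullet> a t)) (at t within {0..T})"
proof -
  have "((\<lambda>s. B0 \<bullet> v s) has_vector_derivative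
     (B0 \<bullet> ((1/\<epsilon>) *\<^sub>R cross3 (v t) B0 + a t) + 0 \<bullet> v t)) (at t within {0..T})"
    by (intro has_vector_derivative_inner v'_a assms has_vector_derivative_const)
  then show ?thesis
    unfolding w_def[abs_def] by (simp add: inner_add_right dot_cross_self)
qed

text \<open>The component of \<open>v\<close> along \<open>B0\<close> yields a cross product
  orthogonal to \<open>B0\<close>. Hence the magnetic part of the parallel force is linear in
  \<open>vp\<close> and can be averaged.\<close>

lemma B0_cross_v: "B0 \<bullet> cross3 (v t) F = B0 \<bullet> cross3 (vp t) F"
  by (subst v_split) (simp add: cross_add_left cross_mult_left inner_add_right dot_cross_self)

lemma B0_a: "B0 \<bullet> a t = B0 \<bullet> cross3 (vp t) (B1 t + \<epsilon> *\<^sub>R B2 t) + B0 \<bullet> E t"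
  by (simp add: a_def inner_add_right B0_cross_v)

lemma abs_B0_a: assumes "t \<in> {0..T}" shows "\<bar>B0 \<bullet> a t\<bar> \<le> 2 * \<beta> * u t + 3 * \<beta>"
proof -
  have "\<bar>B0 \<bullet> cross3 (vp t) (B1 t + \<epsilon> *\<^sub>R B2 t)\<bar> \<le> 1 * (u t * (2 * \<beta>))"
    by (intro abs_inner_bound norm_cross3_bound norm_Btot assms) (simp_all add: B0 norm_vp)
  moreover have "\<bar>B0 \<bullet> E t\<bar> \<le> 1 * (3 * \<beta>)"
    by (intro abs_inner_bound norm_E assms) (simp add: B0)
  ultimately show ?thesis unfolding B0_a by (auto simp: algebra_simps)
qed

text \<open>The forcing \<open>B\<^sub>0 \<bullet> (v\<^sub>\<perp> \<times> B\<^sub>1)\<close> is of the size of \<open>v\<^sub>\<perp>\<close> but, up to \<open>O(\<epsilon>)\<close>, it is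
  the derivative of \<open>\<epsilon> B\<^sub>0 \<bullet> (J \<times> g)\<close>.\<close>

definition w1 :: "real \<Rightarrow> real" where "w1 t = w t - \<epsilon> *\<^sub>R (B0 \<bullet> cross3 (J t) (g t))"
definition w1' :: "real \<Rightarrow> real" where
  "w1' t = B0 \<bullet> a t - \<epsilon> *\<^sub>R (B0 \<bullet> (cross3 (J t) (g' t) + cross3 (J' t) (g t)))"

lemma w1_deriv: assumes "t \<in> {0..T}" shows "(w1 has_vector_derivative w1' t) (at t within {0..T})"
proof -
  have "((\<lambda>s. w s - \<epsilon> *\<^sub>R (B0 \<bullet> cross3 (J s) (g s))) has_vector_derivative
     (B0 \<bullet> a t - \<epsilon> *\<^sub>R (B0 \<bullet> (cross3 (J t) (g' t) + cross3 (J' t) (g t)) + 0 \<bullet> cross3 (J t) (g t)))) (at t within {0..T})"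
    by (intro has_vector_derivative_diff w_deriv assms
      bounded_linear.has_vector_derivative[OF bounded_linear_scaleR_right] has_vector_derivative_inner has_vector_derivative_cross3
      J_deriv g' has_vector_derivative_const)
  then show ?thesis unfolding w1_def[abs_def] w1'_def by simp
qed

text \<open>The \<open>vp\<close> contained in \<open>\<epsilon> *\<^sub>R J' t\<close> merges the
  correction with the forcing: \<open>B1\<close> becomes \<open>B1 - g\<close>, which is of size
  \<open>\<epsilon> * u t\<close>.\<close>

lemma w1'_eq: "w1' t = B0 \<bullet> cross3 (vp t) (B1 t - g t) + \<epsilon> * (B0 \<bullet> cross3 (vp t) (B2 t)) + B0 \<bullet> E t
    - \<epsilon> * (B0 \<bullet> cross3 (cross3 B0 (a t)) (g t)) - \<epsilon> * (B0 \<bullet> cross3 (J t) (g' t))"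
proof -
  have "\<epsilon> * (B0 \<bullet> cross3 (J' t) (g t)) = B0 \<bullet> cross3 (\<epsilon> *\<^sub>R J' t) (g t)"
    by (simp add: cross_mult_left)
  then show ?thesis
    unfolding w1'_def eps_J' B0_a
    by (simp add: cross_add_left cross_add_right cross_mult_left cross_mult_right inner_add_right
      inner_diff_right Cross3.right_diff_distrib algebra_simps)
qed

lemma w1'_bound: assumes t: "t \<in> {0..T}" shows "\<bar>w1' t\<bar> \<le> 12 * \<beta>\<^sup>2"
proof -
  have bb: "\<beta> * 1 \<le> \<beta> * \<beta>" using \<beta> by (intro mult_left_mono) auto
  have "\<bar>B0 \<bullet> cross3 (vp t) (B1 t - g t)\<bar> \<le> 1 * (u t * (\<beta> * (\<epsilon> * u t)))"
    by (intro abs_inner_bound norm_cross3_bound) (simp_all add: B0 norm_vp B1_g_u[OF t])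
  also have "\<dots> = \<beta> * (\<epsilon> * (u t * u t))" by simp
  also have "\<dots> \<le> \<beta> * 1" using \<beta> eps_v[OF t] by (intro mult_left_mono) auto
  finally have 1: "\<bar>B0 \<bullet> cross3 (vp t) (B1 t - g t)\<bar> \<le> \<beta>" by simp
  have "\<bar>\<epsilon> * (B0 \<bullet> cross3 (vp t) (B2 t))\<bar> \<le> \<epsilon> * (1 * (u t * \<beta>))"
    unfolding abs_mult using \<epsilon> field_le(2)[OF t]
    by (intro mult_mono abs_inner_bound norm_cross3_bound) (simp_all add: B0 norm_vp)
  also have "\<dots> = \<beta> * (\<epsilon> * u t)" by simp
  also have "\<dots> \<le> \<beta> * 1" using \<beta> eps_v[OF t] by (intro mult_left_mono) auto
  finally have 2: "\<bar>\<epsilon> * (B0 \<bullet> cross3 (vp t) (B2 t))\<bar> \<le> \<beta>" by simp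
  have 3: "\<bar>B0 \<bullet> E t\<bar> \<le> 1 * (3 * \<beta>)"
    by (intro abs_inner_bound norm_E t) (simp add: B0)
  have "\<bar>\<epsilon> * (B0 \<bullet> cross3 (cross3 B0 (a t)) (g t))\<bar> \<le> \<epsilon> * (1 * ((1 * (2 * \<beta> * norm (v t) + 3 * \<beta>)) * \<beta>))"
    unfolding abs_mult using \<epsilon> field_le(6)[OF t] norm_a[OF t]
    by (intro mult_mono abs_inner_bound norm_cross3_bound) (simp_all add: B0)
  also have "\<dots> = (\<beta> * \<beta>) * (2 * (\<epsilon> * norm (v t)) + 3 * \<epsilon>)" by (simp add: algebra_simps)
  also have "\<dots> \<le> (\<beta> * \<beta>) * 5" using \<beta> eps_v(1)[OF t] \<epsilon> by (intro mult_left_mono) auto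
  finally have 4: "\<bar>\<epsilon> * (B0 \<bullet> cross3 (cross3 B0 (a t)) (g t))\<bar> \<le> (\<beta> * \<beta>) * 5" .
  have "\<bar>\<epsilon> * (B0 \<bullet> cross3 (J t) (g' t))\<bar> \<le> \<epsilon> * (1 * (u t * (\<beta> * (\<epsilon> * (1 + norm (v t))))))"
    unfolding abs_mult using \<epsilon> g'_le[OF t]
    by (intro mult_mono abs_inner_bound norm_cross3_bound) (simp_all add: B0 u_def)
  also have "\<dots> = \<beta> * ((\<epsilon> * u t) * (\<epsilon> * (1 + norm (v t))))" by simp
  also have "\<dots> \<le> \<beta> * (1 * 2)" using \<beta> eps_v[OF t] \<epsilon> u_nonneg[of t] by (intro mult_left_mono mult_mono) auto
  finally have 5: "\<bar>\<epsilon> * (B0 \<bullet> cross3 (J t) (g' t))\<bar> \<le> \<beta> * 2" by simp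
  \<comment> \<open>The five terms sum to \<open>7 * \<beta> + 5 * \<beta>\<^sup>2\<close>, and
    \<open>\<beta>\<close> is at most its square.\<close>
  show ?thesis
    unfolding w1'_eq power2_eq_square using 1 2 3 4 5 bb by linarith
qed

lemma w1_w: assumes t: "t \<in> {0..T}" shows "\<bar>w1 t - w t\<bar> \<le> \<beta>"
proof -
  have "\<bar>\<epsilon> * (B0 \<bullet> cross3 (J t) (g t))\<bar> \<le> \<epsilon> * (1 * (u t * \<beta>))"
    unfolding abs_mult using \<epsilon> field_le(6)[OF t]
    by (intro mult_mono abs_inner_bound norm_cross3_bound) (simp_all add: B0 u_def)
  also have "\<dots> = \<beta> * (\<epsilon> * u t)" by simp
  also have "\<dots> \<le> \<beta> * 1" using \<beta> eps_v[OF t] by (intro mult_left_mono) auto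
  finally show ?thesis unfolding w1_def by simp
qed

text \<open>Since \<open>x\<close> stays in a ball of radius \<open>r\<close>, the parallel velocity is at most \<open>2 r\<close> somewhere in each time
  interval of length 1.\<close>

lemma w_bound: assumes t: "t \<in> {0..T}" and M: "norm (v 0) \<le> M"
  shows "\<bar>w t\<bar> \<le> M + 2 * r + 14 * \<beta>\<^sup>2"
proof -
  have M0: "0 \<le> M" using M norm_ge_zero order_trans by blast
  have "\<exists>s\<in>{0..t}. t - s \<le> 1 \<and> \<bar>w s\<bar> \<le> M + 2 * r"
  proof (cases "t \<le> 1")
    case True
    have "\<bar>w 0\<bar> \<le> 1 * M" unfolding w_def by (intro abs_inner_bound M) (simp add: B0)
    then show ?thesis using True t r by (intro bexI[of _ 0]) auto
  next
    case False
    have D: "((\<lambda>s. B0 \<bullet> x s) has_derivative (\<lambda>h. h * w s)) (at s within {t-1..t})" if "t - 1 \<le> s" "s \<le> t" for s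
    proof -
      have "((\<lambda>s. B0 \<bullet> x s) has_vector_derivative (B0 \<bullet> v s + 0 \<bullet> x s)) (at s within {0..T})"
        by (intro has_vector_derivative_inner x' has_vector_derivative_const) (use that t False in auto)
      then have "((\<lambda>s. B0 \<bullet> x s) has_vector_derivative w s) (at s within {0..T})" by (simp add: w_def)
      then have "((\<lambda>s. B0 \<bullet> x s) has_vector_derivative w s) (at s within {t-1..t})"
        by (rule has_vector_derivative_within_subset) (use t False in auto)
      then show ?thesis by (simp add: has_vector_derivative_def)
    qed
    have "\<exists>s\<in>{t-1..t}. B0 \<bullet> x t - B0 \<bullet> x (t - 1) = (t - (t - 1)) * w s"
      by (rule mvt_very_simple[OF _ D]) auto
    then obtain s where s: "s \<in> {t-1..t}" "w s = B0 \<bullet> x t - B0 \<bullet> x (t - 1)" by auto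
    have "\<bar>B0 \<bullet> x q\<bar> \<le> 1 * r" if "q \<in> {0..T}" for q by (intro abs_inner_bound x_le that) (simp add: B0)
    from this[of t] this[of "t-1"] s t False M0 show ?thesis by (intro bexI[of _ s]) auto
  qed
  then obtain s where s: "s \<in> {0..t}" "t - s \<le> 1" "\<bar>w s\<bar> \<le> M + 2 * r" by blast
  have "\<exists>q\<in>{s..t}. w1 t - w1 s = (t - s) * w1' q"
  proof (rule mvt_very_simple)
    fix q assume "s \<le> q" "q \<le> t"
    then have "(w1 has_vector_derivative w1' q) (at q within {s..t})"
      by (intro has_vector_derivative_within_subset[OF w1_deriv]) (use s t in auto)
    then show "(w1 has_derivative (\<lambda>h. h * w1' q)) (at q within {s..t})"
      by (simp add: has_vector_derivative_def)
  qed (use s in auto)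
  then obtain q where q: "q \<in> {s..t}" "w1 t - w1 s = (t - s) * w1' q" by blast
  have "\<bar>(t - s) * w1' q\<bar> \<le> 1 * (12 * \<beta>\<^sup>2)"
    unfolding abs_mult by (intro mult_mono w1'_bound) (use s t q in auto)
  then have "\<bar>w1 t - w1 s\<bar> \<le> 12 * \<beta>\<^sup>2" using q by simp
  moreover have "\<bar>w1 t - w t\<bar> \<le> \<beta>" "\<bar>w1 s - w s\<bar> \<le> \<beta>" using w1_w s t by auto
  moreover have "\<beta> * 1 \<le> \<beta> * \<beta>" using \<beta> by (intro mult_left_mono) auto
  \<comment> \<open>The constant 14 consists of 12 from the change of \<open>w1\<close> over a time
    of at most 1 and of two differences between \<open>w1\<close> and \<open>w\<close>.\<close>
  ultimately show ?thesis using s unfolding power2_eq_square by linarith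
qed

section \<open>Adiabatic invariant and bound on the perpendicular velocity\<close>

text \<open>The power \<open>v\<^sub>\<perp> \<bullet> (w B\<^sub>0 \<times> B\<^sub>1 + E\<^sub>\<perp>)\<close> is, up to \<open>O(\<epsilon>)\<close>, the derivative of
  \<open>\<epsilon> h \<bullet> J\<close>, so that \<open>Q\<close> is an adiabatic invariant.\<close>

definition h :: "real \<Rightarrow> real^3" where "h t = w t *\<^sub>R cross3 B0 (g t) + f t"
definition h' :: "real \<Rightarrow> real^3" where
  "h' t = w t *\<^sub>R cross3 B0 (g' t) + (B0 \<bullet> a t) *\<^sub>R cross3 B0 (g t) + f' t"
definition Q :: "real \<Rightarrow> real" where "Q t = (1/2) *\<^sub>R (J t \<bullet> J t) - \<epsilon> *\<^sub>R (h t \<bullet> J t)"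
definition Q' :: "real \<Rightarrow> real" where "Q' t = J t \<bullet> J' t - \<epsilon> * (h t \<bullet> J' t) - \<epsilon> * (h' t \<bullet> J t)"

lemma h_deriv: assumes "t \<in> {0..T}" shows "(h has_vector_derivative h' t) (at t within {0..T})"
proof -
  have "((\<lambda>s. w s *\<^sub>R cross3 B0 (g s) + f s) has_vector_derivative
     (w t *\<^sub>R (cross3 B0 (g' t) + cross3 0 (g t)) + (B0 \<bullet> a t) *\<^sub>R cross3 B0 (g t) + f' t)) (at t within {0..T})"
    by (intro has_vector_derivative_add f' assms has_vector_derivative_cross3 has_vector_derivative_const g'
       bounded_bilinear.has_vector_derivative[OF bounded_bilinear_scaleR] w_deriv)
  then show ?thesis unfolding h_def[abs_def] h'_def by simp
qed

lemma Q_deriv: assumes "t \<in> {0..T}" shows "(Q has_vector_derivative Q' t) (at t within {0..T})"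
proof -
  have "((\<lambda>s. (1/2) *\<^sub>R (J s \<bullet> J s) - \<epsilon> *\<^sub>R (h s \<bullet> J s)) has_vector_derivative
     ((1/2) *\<^sub>R (J t \<bullet> J' t + J' t \<bullet> J t) - \<epsilon> *\<^sub>R (h t \<bullet> J' t + h' t \<bullet> J t))) (at t within {0..T})"
    by (intro has_vector_derivative_diff bounded_linear.has_vector_derivative[OF bounded_linear_scaleR_right]
       has_vector_derivative_inner J_deriv h_deriv assms)
  then show ?thesis unfolding Q_def[abs_def] Q'_def by (simp add: inner_commute algebra_simps)
qed

text \<open>The stiff part of \<open>J'\<close> is orthogonal to \<open>J\<close>. In
  \<open>vp t \<bullet> a t\<close> the vector \<open>vp\<close> is orthogonal to its own cross
  products, so only the parallel velocity survives there, and \<open>Epa\<close> drops out as a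
  multiple of \<open>B0\<close>.\<close>

lemma J_J': assumes t: "t \<in> {0..T}"
  shows "J t \<bullet> J' t = vp t \<bullet> (w t *\<^sub>R cross3 B0 (B1 t) + Ep t) + \<epsilon> * (vp t \<bullet> (w t *\<^sub>R cross3 B0 (B2 t) + E2 t))"
proof -
  have "J t \<bullet> J' t = J t \<bullet> cross3 B0 (a t)"
    unfolding J'_def vp_J by (simp add: inner_add_right dot_cross_self)
  also have "\<dots> = v t \<bullet> a t - (B0 \<bullet> a t) * (v t \<bullet> B0)"
    unfolding J_def by (simp add: dot_cross B0_B0)
  also have "\<dots> = vp t \<bullet> a t"
    by (simp add: vp_def P_perp_def P_par_def inner_diff_left inner_commute[of "v t" B0])
  finally have 1: "J t \<bullet> J' t = vp t \<bullet> a t" .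
  have 2: "vp t \<bullet> cross3 (v t) F = w t * (vp t \<bullet> cross3 B0 F)" for F
    by (subst v_split) (simp add: cross_add_left cross_mult_left inner_add_right dot_cross_self)
  have "vp t \<bullet> Epa t = cross3 B0 (Epa t) \<bullet> J t" unfolding vp_J by (rule cross_triple)
  also have "\<dots> = 0" using Epa[OF t] cross_skew[of B0 "Epa t"] by simp
  finally have 3: "vp t \<bullet> Epa t = 0" .
  show ?thesis unfolding 1 a_def E_def
    by (simp add: inner_add_right 2 3 cross_add_right cross_mult_right algebra_simps)
qed

text \<open>The part \<open>vp t \<bullet> h t\<close> of the correction cancels the leading power
  and leaves the differences \<open>B1 - g\<close> and \<open>Ep - f\<close>, so that every term is
  small with \<epsilon>.\<close>

lemma Q'_eq: assumes t: "t \<in> {0..T}"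
  shows "Q' t = vp t \<bullet> (w t *\<^sub>R cross3 B0 (B1 t - g t) + (Ep t - f t))
    + \<epsilon> * (vp t \<bullet> (w t *\<^sub>R cross3 B0 (B2 t) + E2 t)) - \<epsilon> * (h t \<bullet> cross3 B0 (a t)) - \<epsilon> * (h' t \<bullet> J t)"
proof -
  have "\<epsilon> * (h t \<bullet> J' t) = h t \<bullet> (\<epsilon> *\<^sub>R J' t)" by simp
  also have "\<dots> = vp t \<bullet> h t + \<epsilon> * (h t \<bullet> cross3 B0 (a t))"
    unfolding eps_J' by (simp add: inner_add_right inner_commute)
  finally show ?thesis
    unfolding Q'_def J_J'[OF t] h_def
    by (simp add: inner_add_right inner_diff_right Cross3.right_diff_distrib algebra_simps)
qed

context
  fixes W :: real
  assumes W: "1 \<le> W" and w_le: "\<And>t. t \<in> {0..T} \<Longrightarrow> \<bar>w t\<bar> \<le> W"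
begin

lemma norm_h: assumes t: "t \<in> {0..T}" shows "norm (h t) \<le> 2 * W * \<beta>"
proof -
  have "norm (w t *\<^sub>R cross3 B0 (g t)) \<le> W * (1 * \<beta>)"
    by (intro norm_scaleR_bound norm_cross3_bound w_le field_le t) (simp add: B0)
  moreover have "1 * \<beta> \<le> W * \<beta>" using W \<beta> by (intro mult_right_mono) auto
  ultimately show ?thesis
    unfolding h_def using norm_triangle_ineq[of "w t *\<^sub>R cross3 B0 (g t)" "f t"] field_le(7)[OF t] by linarith
qed

lemma v_le_W: assumes t: "t \<in> {0..T}" shows "norm (v t) \<le> W * (1 + u t)"
proof -
  have "1 * u t \<le> W * u t" using W u_nonneg by (intro mult_right_mono) auto
  then show ?thesis using v_le_u_w[of t] w_le[OF t] by (simp add: algebra_simps)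
qed

text \<open>With \<open>k = W * \<beta>\<close> and \<open>s = 1 + u t\<close>, the four terms are
  at most 2, 2, 10 and 9 times \<open>\<epsilon> * (k * k * (s * s))\<close>; passing from
  \<open>s * s\<close> to \<open>1 + (u t)\<^sup>2\<close> doubles 23 to 46. Quadratic growth in
  \<open>u\<close> at a rate of order \<epsilon> is what Gronwall's inequality absorbs up to time
  \<open>c / \<epsilon>\<close>.\<close>

lemma Q'_bound: assumes t: "t \<in> {0..T}"
  shows "Q' t \<le> \<epsilon> * (46 * (W * \<beta>)\<^sup>2) * (1 + (u t)\<^sup>2)"
proof -
  define s where "s = 1 + u t"
  have s: "1 \<le> s" "u t \<le> s" "0 \<le> s" using u_nonneg[of t] by (auto simp: s_def)
  define k where "k = W * \<beta>"
  have k: "1 \<le> k" "\<beta> \<le> k" "W \<le> k"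
    using mult_mono[of 1 W 1 \<beta>] mult_right_mono[of 1 W \<beta>] mult_left_mono[of 1 \<beta> W] W \<beta> by (auto simp: k_def)
  have kk: "k \<le> k * k" using k mult_left_mono[of 1 k k] by simp
  have ss: "s \<le> s * s" using s mult_left_mono[of 1 s s] by simp
  have us: "u t * u t \<le> s * s" "u t \<le> s * s"
    using mult_mono[OF s(2) s(2)] u_nonneg[of t] s order_trans[OF s(2) ss] by auto
  have b: "norm (w t *\<^sub>R cross3 B0 X + Y) \<le> 2 * k * c"
    if "norm X \<le> \<beta> * c" "norm Y \<le> \<beta> * c" "0 \<le> c" for X Y c
  proof -
    have "norm (w t *\<^sub>R cross3 B0 X) \<le> W * (1 * (\<beta> * c))"
      by (intro norm_scaleR_bound norm_cross3_bound w_le t that) (simp add: B0)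
    then have "norm (w t *\<^sub>R cross3 B0 X) \<le> k * c" by (simp add: k_def)
    moreover have "\<beta> * c \<le> k * c" by (intro mult_right_mono k that)
    ultimately show ?thesis using norm_triangle_ineq[of "w t *\<^sub>R cross3 B0 X" Y] that(2) by linarith
  qed
  have "\<bar>vp t \<bullet> (w t *\<^sub>R cross3 B0 (B1 t - g t) + (Ep t - f t))\<bar> \<le> u t * (2 * k * (\<epsilon> * u t))"
    by (intro abs_inner_bound b B1_g_u Ep_f_u t mult_nonneg_nonneg u_nonneg) (use \<epsilon> in \<open>auto simp: norm_vp\<close>)
  also have "\<dots> = \<epsilon> * (2 * k * (u t * u t))" by simp
  also have "\<dots> \<le> \<epsilon> * (2 * (k * k) * (s * s))"
    by (intro mult_left_mono mult_mono us) (use \<epsilon> k kk u_nonneg[of t] in auto)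
  finally have 1: "\<bar>vp t \<bullet> (w t *\<^sub>R cross3 B0 (B1 t - g t) + (Ep t - f t))\<bar> \<le> 2 * (\<epsilon> * (k * k * (s * s)))" by (simp add: algebra_simps)
  have "\<bar>vp t \<bullet> (w t *\<^sub>R cross3 B0 (B2 t) + E2 t)\<bar> \<le> u t * (2 * k * 1)"
    by (intro abs_inner_bound b) (use field_le[OF t] in \<open>auto simp: norm_vp\<close>)
  also have "\<dots> = 2 * k * u t" by simp
  also have "\<dots> \<le> 2 * (k * k) * (s * s)"
    by (intro mult_mono us) (use k kk u_nonneg[of t] in auto)
  finally have "\<epsilon> * \<bar>vp t \<bullet> (w t *\<^sub>R cross3 B0 (B2 t) + E2 t)\<bar> \<le> \<epsilon> * (2 * (k * k) * (s * s))"
    by (intro mult_left_mono) (use \<epsilon> in auto)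
  then have 2: "\<bar>\<epsilon> * (vp t \<bullet> (w t *\<^sub>R cross3 B0 (B2 t) + E2 t))\<bar> \<le> 2 * (\<epsilon> * (k * k * (s * s)))"
    unfolding abs_mult using \<epsilon> by (simp add: algebra_simps)
  have a: "norm (a t) \<le> 5 * k * s"
  proof -
    have "norm (a t) \<le> 2 * \<beta> * (W * (1 + u t)) + 3 * \<beta>"
      using norm_a[OF t] mult_left_mono[OF v_le_W[OF t], of "2 * \<beta>"] \<beta> by linarith
    moreover have "\<beta> * 1 \<le> k * s" using k s \<beta> by (intro mult_mono) auto
    ultimately show ?thesis by (simp add: k_def s_def algebra_simps)
  qed
  have "\<bar>h t \<bullet> cross3 B0 (a t)\<bar> \<le> (2 * W * \<beta>) * (1 * (5 * k * s))"
    by (intro abs_inner_bound norm_cross3_bound norm_h t a) (simp add: B0)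
  also have "\<dots> = 10 * (k * k * s)" by (simp add: k_def)
  also have "\<dots> \<le> 10 * (k * k * (s * s))" by (intro mult_left_mono ss) (use k in auto)
  finally have "\<epsilon> * \<bar>h t \<bullet> cross3 B0 (a t)\<bar> \<le> \<epsilon> * (10 * (k * k * (s * s)))"
    by (intro mult_left_mono) (use \<epsilon> in auto)
  then have 3: "\<bar>\<epsilon> * (h t \<bullet> cross3 B0 (a t))\<bar> \<le> 10 * (\<epsilon> * (k * k * (s * s)))"
    unfolding abs_mult using \<epsilon> by (simp add: algebra_simps)
  have "norm (h' t) \<le> 9 * (k * k) * s"
  proof -
    have c: "0 \<le> \<epsilon> * (1 + norm (v t))" "\<epsilon> * (1 + norm (v t)) \<le> 2" using \<epsilon> eps_v[OF t] by auto
    have "norm (w t *\<^sub>R cross3 B0 (g' t) + f' t) \<le> 2 * k * (\<epsilon> * (1 + norm (v t)))"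
      by (intro b g'_le f'_le t c)
    also have "\<dots> \<le> 2 * k * 2" using k c by (intro mult_left_mono) auto
    also have "\<dots> \<le> 4 * (k * k * s)"
      using kk k s mult_mono[of 1 s k "k * k"] by (auto simp: mult.commute)
    finally have 1: "norm (w t *\<^sub>R cross3 B0 (g' t) + f' t) \<le> 4 * (k * k * s)" .
    have "\<bar>B0 \<bullet> a t\<bar> \<le> 5 * (\<beta> * s)" 
      using abs_B0_a[OF t] \<beta> mult_nonneg_nonneg[OF _ u_nonneg, of \<beta> t] unfolding s_def distrib_left mult.assoc by linarith
    also have "\<dots> \<le> 5 * (k * s)" using k s by (intro mult_left_mono mult_right_mono) auto
    finally have "norm ((B0 \<bullet> a t) *\<^sub>R cross3 B0 (g t)) \<le> (5 * (k * s)) * (1 * k)"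
      by (intro norm_scaleR_bound norm_cross3_bound order_trans[OF field_le(6)[OF t]] k) (simp_all add: B0)
    with 1 norm_triangle_ineq[of "w t *\<^sub>R cross3 B0 (g' t) + f' t" "(B0 \<bullet> a t) *\<^sub>R cross3 B0 (g t)"]
    show ?thesis unfolding h'_def by (simp add: algebra_simps)
  qed
  then have "\<bar>h' t \<bullet> J t\<bar> \<le> (9 * (k * k) * s) * s"
    by (intro abs_inner_bound) (use s in \<open>auto simp: u_def\<close>)
  then have "\<epsilon> * \<bar>h' t \<bullet> J t\<bar> \<le> \<epsilon> * ((9 * (k * k) * s) * s)"
    by (intro mult_left_mono) (use \<epsilon> in auto)
  then have 4: "\<bar>\<epsilon> * (h' t \<bullet> J t)\<bar> \<le> 9 * (\<epsilon> * (k * k * (s * s)))"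
    unfolding abs_mult using \<epsilon> by (simp add: algebra_simps)
  have "Q' t \<le> 23 * (\<epsilon> * (k * k * (s * s)))"
    unfolding Q'_eq[OF t] using 1 2 3 4 by linarith
  also have "\<dots> = 23 * (\<epsilon> * (k * k)) * (s * s)" by simp
  also have "\<dots> \<le> 23 * (\<epsilon> * (k * k)) * (2 * (1 + (u t)\<^sup>2))"
  proof (intro mult_left_mono)
    have "0 \<le> (1 - u t)\<^sup>2" by simp
    then show "s * s \<le> 2 * (1 + (u t)\<^sup>2)" unfolding s_def by (simp add: power2_eq_square algebra_simps)
  qed (use \<epsilon> k in auto)
  also have "\<dots> = \<epsilon> * (46 * (W * \<beta>)\<^sup>2) * (1 + (u t)\<^sup>2)" by (simp add: k_def power2_eq_square)
  finally show ?thesis .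
qed

lemma u_Q: assumes t: "t \<in> {0..T}" shows "\<bar>(u t)\<^sup>2 - 2 * Q t\<bar> \<le> 4 * W * \<beta>"
proof -
  have "\<bar>h t \<bullet> J t\<bar> \<le> (2 * W * \<beta>) * u t"
    by (intro abs_inner_bound norm_h t) (simp add: u_def)
  then have "\<epsilon> * \<bar>h t \<bullet> J t\<bar> \<le> \<epsilon> * ((2 * W * \<beta>) * u t)"
    by (intro mult_left_mono) (use \<epsilon> in auto)
  also have "\<dots> = (2 * W * \<beta>) * (\<epsilon> * u t)" by simp
  also have "\<dots> \<le> (2 * W * \<beta>) * 1" by (intro mult_left_mono eps_v t) (use W \<beta> in auto)
  finally have "\<bar>\<epsilon> * (h t \<bullet> J t)\<bar> \<le> 2 * W * \<beta>" unfolding abs_mult using \<epsilon> by simp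
  moreover have "(u t)\<^sup>2 - 2 * Q t = 2 * (\<epsilon> * (h t \<bullet> J t))" by (simp add: Q_def u_def power2_norm_eq_inner)
  ultimately show ?thesis by linarith
qed

lemma u_bound: assumes t: "t \<in> {0..T}" and M: "norm (v 0) \<le> M" and c: "\<epsilon> * T \<le> c"
  shows "(u t)\<^sup>2 \<le> (M\<^sup>2 + 8 * W * \<beta> + 1) * exp (92 * (W * \<beta>)\<^sup>2 * c)"
proof -
  \<comment> \<open>By \<open>u_Q\<close> this shift gives
    \<open>1 + (u q)\<^sup>2 \<le> 2 * (Q q + ?k)\<close>, so the growth estimate becomes affine in
    \<open>Q\<close>, with rate 92 as twice 46.\<close>
  let ?A = "92 * (W * \<beta>)\<^sup>2" and ?k = "1/2 + 2 * W * \<beta>"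
  have uQ0: "\<bar>(u 0)\<^sup>2 - 2 * Q 0\<bar> \<le> 4 * W * \<beta>" using u_Q[of 0] T by simp
  have "Q' q \<le> (\<epsilon> * ?A) * (Q q + ?k)" if q: "q \<in> {0..T}" for q
  proof -
    have "1 + (u q)\<^sup>2 \<le> 2 * (Q q + ?k)" using u_Q[OF q] unfolding distrib_left by linarith
    then have "\<epsilon> * (46 * (W * \<beta>)\<^sup>2) * (1 + (u q)\<^sup>2) \<le> \<epsilon> * (46 * (W * \<beta>)\<^sup>2) * (2 * (Q q + ?k))"
      by (intro mult_left_mono) (use \<epsilon> in auto)
    with Q'_bound[OF q] show ?thesis by (simp add: algebra_simps)
  qed
  from gronwall_affine[OF Q_deriv this t]
  have "Q t + ?k \<le> (Q 0 + ?k) * exp (\<epsilon> * ?A * t)" .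
  also have "\<dots> \<le> (Q 0 + ?k) * exp (?A * c)"
  proof (rule mult_left_mono)
    have "\<epsilon> * t \<le> \<epsilon> * T" using t \<epsilon> by (intro mult_left_mono) auto
    then have "?A * (\<epsilon> * t) \<le> ?A * c" using c by (intro mult_left_mono) auto
    then show "exp (\<epsilon> * ?A * t) \<le> exp (?A * c)" by (simp add: mult_ac)
    show "0 \<le> Q 0 + ?k" using uQ0 zero_le_power2[of "u 0"] by linarith
  qed
  also have "\<dots> \<le> ((M\<^sup>2 + 8 * W * \<beta> + 1) / 2) * exp (?A * c)"
  proof (rule mult_right_mono)
    have "(u 0)\<^sup>2 \<le> M\<^sup>2" using u_le_v[of 0] M u_nonneg[of 0] by (intro power_mono) auto
    then show "Q 0 + ?k \<le> (M\<^sup>2 + 8 * W * \<beta> + 1) / 2" using uQ0 by (simp add: abs_le_iff)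
  qed simp
  finally show ?thesis using u_Q[OF t] by (simp add: abs_le_iff)
qed

end

text \<open>The right-hand side contains neither \<open>R\<close> nor \<epsilon> nor
  \<open>T\<close>, so \<open>R\<close> can be chosen above it and the continuity argument
  closes.\<close>

lemma v_bound: assumes t: "t \<in> {0..T}" and M: "norm (v 0) \<le> M" and c: "\<epsilon> * T \<le> c"
    and W: "W = M + 2 * r + 14 * \<beta>\<^sup>2"
  shows "norm (v t) \<le> sqrt ((M\<^sup>2 + 8 * W * \<beta> + 1) * exp (92 * (W * \<beta>)\<^sup>2 * c)) + W"
proof -
  have w: "\<bar>w s\<bar> \<le> W" if "s \<in> {0..T}" for s unfolding W by (rule w_bound[OF that M])
  have "1 \<le> W"
    using one_le_power[OF \<beta>, of 2] order_trans[OF norm_ge_zero M] r unfolding W by linarith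
  from u_bound[OF this w t M c]
  have "u t \<le> sqrt ((M\<^sup>2 + 8 * W * \<beta> + 1) * exp (92 * (W * \<beta>)\<^sup>2 * c))" by (rule real_le_rsqrt)
  then show ?thesis using v_le_u_w[of t] w[OF t] by simp
qed

section \<open>The corrected guiding centre and the slow equation\<close>

text \<open>The drift \<open>-\<epsilon> B\<^sub>0 \<times> (v \<times> B\<^sub>1)\<close> of \<open>x\<^sub>\<perp> - \<epsilon> J\<close> is cancelled to first order by the last term of \<open>z\<close>, since
  \<open>\<epsilon> J + (B\<^sub>0 \<bullet> x) B\<^sub>0\<close> has derivative \<open>v + O(\<epsilon>)\<close>; this uses that \<open>B\<^sub>0 \<bullet> x\<close> is bounded.\<close>

definition z :: "real \<Rightarrow> real^3" where
  "z t = P_perp B0 (x t) - \<epsilon> *\<^sub>R J t + \<epsilon> *\<^sub>R cross3 B0 (cross3 (\<epsilon> *\<^sub>R J t + (B0 \<bullet> x t) *\<^sub>R B0) (g t))"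
definition z' :: "real \<Rightarrow> real^3" where
  "z' t = vp t - \<epsilon> *\<^sub>R J' t + \<epsilon> *\<^sub>R cross3 B0 (cross3 (\<epsilon> *\<^sub>R J t + (B0 \<bullet> x t) *\<^sub>R B0) (g' t)
     + cross3 (\<epsilon> *\<^sub>R J' t + w t *\<^sub>R B0) (g t))"

lemma z_deriv: assumes t: "t \<in> {0..T}" shows "(z has_vector_derivative z' t) (at t within {0..T})"
proof -
  have Bx: "((\<lambda>s. B0 \<bullet> x s) has_vector_derivative w t) (at t within {0..T})"
    using has_vector_derivative_inner[OF has_vector_derivative_const x'[OF t], of B0] by (simp add: w_def)
  have B: "((\<lambda>s. (B0 \<bullet> x s) *\<^sub>R B0) has_vector_derivative w t *\<^sub>R B0) (at t within {0..T})"
    by (rule bounded_linear.has_vector_derivative[OF bounded_linear_scaleR_left Bx])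
  have J: "((\<lambda>s. \<epsilon> *\<^sub>R J s) has_vector_derivative \<epsilon> *\<^sub>R J' t) (at t within {0..T})"
    by (rule bounded_linear.has_vector_derivative[OF bounded_linear_scaleR_right J_deriv[OF t]])
  have P: "((\<lambda>s. P_perp B0 (x s)) has_vector_derivative vp t) (at t within {0..T})"
    unfolding vp_def by (rule bounded_linear.has_vector_derivative[OF bounded_linear_P_perp x'[OF t]])
  have "((\<lambda>s. P_perp B0 (x s) - \<epsilon> *\<^sub>R J s + \<epsilon> *\<^sub>R cross3 B0 (cross3 (\<epsilon> *\<^sub>R J s + (B0 \<bullet> x s) *\<^sub>R B0) (g s)))
     has_vector_derivative (vp t - \<epsilon> *\<^sub>R J' t + \<epsilon> *\<^sub>R (cross3 B0 (cross3 (\<epsilon> *\<^sub>R J t + (B0 \<bullet> x t) *\<^sub>R B0) (g' t)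
     + cross3 (\<epsilon> *\<^sub>R J' t + w t *\<^sub>R B0) (g t)) + cross3 0 (cross3 (\<epsilon> *\<^sub>R J t + (B0 \<bullet> x t) *\<^sub>R B0) (g t)))))
     (at t within {0..T})"
    by (intro has_vector_derivative_add has_vector_derivative_diff P J B g' t
      bounded_linear.has_vector_derivative[OF bounded_linear_scaleR_right] has_vector_derivative_cross3
      has_vector_derivative_const)
  then show ?thesis unfolding z_def[abs_def] z'_def by simp
qed

text \<open>\<open>vp\<close> cancels against \<open>\<epsilon> *\<^sub>R J'\<close>, leaving the
  drift of \<open>a\<close>. In it \<open>v \<times> B1\<close> is reduced to
  \<open>v \<times> (B1 - g)\<close> by the last term of \<open>z\<close>, \<open>Epa\<close>
  vanishes under the cross product with \<open>B0\<close>, and \<open>Ep\<close> gives the slow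
  drift.\<close>

lemma z'_eq: assumes t: "t \<in> {0..T}"
  shows "z' t - \<epsilon> *\<^sub>R cross3 (Ep t) B0 =
    \<epsilon> *\<^sub>R (cross3 B0 (cross3 (\<epsilon> *\<^sub>R J t + (B0 \<bullet> x t) *\<^sub>R B0) (g' t)) - cross3 B0 (cross3 (v t) (B1 t - g t))
    - \<epsilon> *\<^sub>R cross3 B0 (E2 t) - \<epsilon> *\<^sub>R cross3 B0 (cross3 (v t) (B2 t)) + \<epsilon> *\<^sub>R cross3 B0 (cross3 (cross3 B0 (a t)) (g t)))"
proof -
  have 1: "\<epsilon> *\<^sub>R J' t + w t *\<^sub>R B0 = v t + \<epsilon> *\<^sub>R cross3 B0 (a t)"
    unfolding eps_J' by (simp add: v_split[of t] add_ac)
  have 2: "cross3 B0 (Epa t) = 0" using Epa[OF t] cross_skew[of B0 "Epa t"] by simp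
  have 3: "cross3 B0 (a t) = cross3 B0 (cross3 (v t) (B1 t)) + \<epsilon> *\<^sub>R cross3 B0 (cross3 (v t) (B2 t))
     - cross3 (Ep t) B0 + \<epsilon> *\<^sub>R cross3 B0 (E2 t)"
    unfolding a_def E_def cross_skew[of "Ep t" B0]
    by (simp add: cross_add_right cross_mult_right 2)
  have 4: "vp t - \<epsilon> *\<^sub>R J' t = - \<epsilon> *\<^sub>R cross3 B0 (a t)" unfolding eps_J' by simp
  have 5: "cross3 B0 (cross3 (v t + \<epsilon> *\<^sub>R cross3 B0 (a t)) (g t)) =
     cross3 B0 (cross3 (v t) (g t)) + \<epsilon> *\<^sub>R cross3 B0 (cross3 (cross3 B0 (a t)) (g t))"
    by (simp add: cross_add_left cross_mult_left cross_add_right cross_mult_right)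
  show ?thesis unfolding z'_def 1 4 cross_add_right[of B0] 5 Cross3.right_diff_distrib
    by (subst 3) (simp add: algebra_simps)
qed

lemma norm_z_arg: assumes t: "t \<in> {0..T}"
  shows "norm (\<epsilon> *\<^sub>R J t + (B0 \<bullet> x t) *\<^sub>R B0) \<le> R + r"
proof -
  have "u t \<le> R" using u_le_v[of t] v_le[OF t] by simp
  then have "norm (\<epsilon> *\<^sub>R J t) \<le> 1 * R" by (intro norm_scaleR_bound) (use \<epsilon> in \<open>auto simp: u_def\<close>)
  moreover have "\<bar>B0 \<bullet> x t\<bar> \<le> 1 * r" by (intro abs_inner_bound x_le t) (simp add: B0)
  ultimately show ?thesis
    using norm_triangle_ineq[of "\<epsilon> *\<^sub>R J t" "(B0 \<bullet> x t) *\<^sub>R B0"] B0 by simp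
qed

text \<open>Each term in the bracket of \<open>z'_eq\<close> has a second factor \<epsilon>, either
  explicit or from \<open>g'\<close> or \<open>B1 - g\<close>. Dependence on \<open>R\<close> is
  harmless here, since the velocity bound is settled separately.\<close>

lemma z'_bound: assumes t: "t \<in> {0..T}"
  shows "norm (z' t - \<epsilon> *\<^sub>R cross3 (Ep t) B0) \<le>
    \<epsilon>\<^sup>2 * ((R + r) * (\<beta> * (1 + R)) + R * (\<beta> * R) + \<beta> + R * \<beta> + (2 * \<beta> * R + 3 * \<beta>) * \<beta>)"
proof -
  note vR = v_le[OF t]
  have uR: "u t \<le> R" using u_le_v[of t] vR by simp
  have a: "norm (a t) \<le> 2 * \<beta> * R + 3 * \<beta>"
    using norm_a[OF t] mult_left_mono[OF vR, of "2 * \<beta>"] \<beta> by linarith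
  have "norm (g' t) \<le> \<beta> * (\<epsilon> * (1 + norm (v t)))" by (rule g'_le[OF t])
  also have "\<dots> \<le> \<beta> * (\<epsilon> * (1 + R))" using \<beta> \<epsilon> vR by (intro mult_left_mono) auto
  finally have gR: "norm (g' t) \<le> \<beta> * (\<epsilon> * (1 + R))" .
  have "norm (cross3 B0 (cross3 (\<epsilon> *\<^sub>R J t + (B0 \<bullet> x t) *\<^sub>R B0) (g' t))) \<le> 1 * ((R + r) * (\<beta> * (\<epsilon> * (1 + R))))"
    by (intro norm_cross3_bound norm_z_arg t gR) (simp add: B0)
  then have 1: "norm (cross3 B0 (cross3 (\<epsilon> *\<^sub>R J t + (B0 \<bullet> x t) *\<^sub>R B0) (g' t))) \<le> \<epsilon> * ((R + r) * (\<beta> * (1 + R)))" by (simp add: mult_ac)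
  have "\<beta> * (\<epsilon> * u t) \<le> \<beta> * (\<epsilon> * R)" using \<beta> \<epsilon> uR by (intro mult_left_mono) auto
  then have "norm (B1 t - g t) \<le> \<beta> * (\<epsilon> * R)" using B1_g_u[OF t] by linarith
  then have "norm (cross3 B0 (cross3 (v t) (B1 t - g t))) \<le> 1 * (R * (\<beta> * (\<epsilon> * R)))"
    by (intro norm_cross3_bound vR) (simp add: B0)
  then have 2: "norm (cross3 B0 (cross3 (v t) (B1 t - g t))) \<le> \<epsilon> * (R * (\<beta> * R))" by (simp add: mult_ac)
  have 3: "norm (\<epsilon> *\<^sub>R cross3 B0 (E2 t)) \<le> \<epsilon> * (1 * \<beta>)"
    by (intro norm_scaleR_bound norm_cross3_bound field_le t) (use \<epsilon> in \<open>simp_all add: B0\<close>)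
  have 4: "norm (\<epsilon> *\<^sub>R cross3 B0 (cross3 (v t) (B2 t))) \<le> \<epsilon> * (1 * (R * \<beta>))"
    by (intro norm_scaleR_bound norm_cross3_bound field_le t vR) (use \<epsilon> in \<open>simp_all add: B0\<close>)
  have 5: "norm (\<epsilon> *\<^sub>R cross3 B0 (cross3 (cross3 B0 (a t)) (g t))) \<le> \<epsilon> * (1 * ((1 * (2 * \<beta> * R + 3 * \<beta>)) * \<beta>))"
    by (intro norm_scaleR_bound norm_cross3_bound field_le t a) (use \<epsilon> in \<open>simp_all add: B0\<close>)
  have tri: "norm (p1 - p2 - p3 - p4 + p5) \<le> norm p1 + norm p2 + norm p3 + norm p4 + norm p5"
    for p1 p2 p3 p4 p5 :: "real^3"
    by (intro order_trans[OF norm_triangle_ineq] order_trans[OF norm_triangle_ineq4] add_mono order_refl)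
  have "norm (z' t - \<epsilon> *\<^sub>R cross3 (Ep t) B0) \<le> \<epsilon> * (\<epsilon> * ((R + r) * (\<beta> * (1 + R))) + \<epsilon> * (R * (\<beta> * R)) + \<epsilon> * (1 * \<beta>)
     + \<epsilon> * (1 * (R * \<beta>)) + \<epsilon> * (1 * ((1 * (2 * \<beta> * R + 3 * \<beta>)) * \<beta>)))"
    unfolding z'_eq[OF t]
    by (intro norm_scaleR_bound order_trans[OF tri] add_mono 1 2 3 4 5) (use \<epsilon> in auto)
  then show ?thesis by (simp add: power2_eq_square algebra_simps)
qed

lemma z_near: assumes t: "t \<in> {0..T}"
  shows "norm (z t - P_perp B0 (x t)) \<le> \<epsilon> * (R + (R + r) * \<beta>)"
proof -
  have uR: "u t \<le> R" using u_le_v[of t] v_le[OF t] by simp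
  have 1: "norm (\<epsilon> *\<^sub>R cross3 B0 (cross3 (\<epsilon> *\<^sub>R J t + (B0 \<bullet> x t) *\<^sub>R B0) (g t))) \<le> \<epsilon> * (1 * ((R + r) * \<beta>))"
    by (intro norm_scaleR_bound norm_cross3_bound field_le t norm_z_arg) (use \<epsilon> in \<open>simp_all add: B0\<close>)
  have 2: "norm (\<epsilon> *\<^sub>R J t) \<le> \<epsilon> * R" by (intro norm_scaleR_bound) (use \<epsilon> uR in \<open>auto simp: u_def\<close>)
  have "z t - P_perp B0 (x t) = \<epsilon> *\<^sub>R cross3 B0 (cross3 (\<epsilon> *\<^sub>R J t + (B0 \<bullet> x t) *\<^sub>R B0) (g t)) - \<epsilon> *\<^sub>R J t"
    by (simp add: z_def)
  then show ?thesis
    using 1 2 norm_triangle_ineq4[of "\<epsilon> *\<^sub>R cross3 B0 (cross3 (\<epsilon> *\<^sub>R J t + (B0 \<bullet> x t) *\<^sub>R B0) (g t))" "\<epsilon> *\<^sub>R J t"]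
    by (simp add: distrib_left)
qed

end

text \<open>The first summand is the coefficient of \<open>\<epsilon>\<^sup>2\<close> in
  \<open>z'_bound\<close>, the second that of \<epsilon> in \<open>z_near\<close>.\<close>

definition drift_error :: "real \<Rightarrow> real \<Rightarrow> real \<Rightarrow> real" where
  "drift_error \<beta> R r = ((R + r) * (\<beta> * (1 + R)) + R * (\<beta> * R) + \<beta> + R * \<beta> + (2 * \<beta> * R + 3 * \<beta>) * \<beta>)
     + (R + (R + r) * \<beta>)"

text \<open>Gronwall's inequality is applied to \<open>z - y\<close>. The field along
  \<open>y\<close> is kept abstract as \<open>G\<close>, with its own Lipschitz constant
  \<open>\<Lambda>\<close>, so that the estimate serves for the global and for the local
  constant.\<close>

lemma (in gyration) slow_close:
  fixes G y :: "real \<Rightarrow> real^3"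
  assumes y0: "y 0 = P_perp B0 (x 0)"
    and y': "\<And>t. t \<in> {0..T} \<Longrightarrow> (y has_vector_derivative (\<epsilon> *\<^sub>R cross3 (G t) B0)) (at t within {0..T})"
    and \<Lambda>: "1 \<le> \<Lambda>"
    and G: "\<And>t. t \<in> {0..T} \<Longrightarrow> norm (Ep t - G t) \<le> \<Lambda> * norm (P_perp B0 (x t) - y t)"
    and c: "\<epsilon> * T \<le> c" and t: "t \<in> {0..T}"
  shows "norm (P_perp B0 (x t) - y t) \<le> (drift_error \<beta> R r * (1 + 2 * exp (3 * \<Lambda> * c))) * \<epsilon>"
proof -
  define A4 where "A4 = (R + r) * (\<beta> * (1 + R)) + R * (\<beta> * R) + \<beta> + R * \<beta> + (2 * \<beta> * R + 3 * \<beta>) * \<beta>"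
  define A5 where "A5 = R + (R + r) * \<beta>"
  have A: "drift_error \<beta> R r = A4 + A5" by (simp add: drift_error_def A4_def A5_def)
  have A0: "0 \<le> A4" "0 \<le> A5" unfolding A4_def A5_def using R \<beta> r by auto
  let ?A = "A4 + A5"
  have zx: "norm (z s - P_perp B0 (x s)) \<le> \<epsilon> * A5" if "s \<in> {0..T}" for s
    unfolding A5_def by (rule z_near[OF that])
  have "norm (z' s - \<epsilon> *\<^sub>R cross3 (G s) B0) \<le> \<epsilon> * \<Lambda> * (norm (z s - y s) + \<epsilon> * ?A)" if s: "s \<in> {0..T}" for s
  proof -
    have "norm (P_perp B0 (x s) - y s) \<le> norm (z s - y s) + \<epsilon> * A5"
      using norm_triangle_ineq4[of "z s - y s" "z s - P_perp B0 (x s)"] zx[OF s] by simp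
    then have "\<Lambda> * norm (P_perp B0 (x s) - y s) \<le> \<Lambda> * (norm (z s - y s) + \<epsilon> * A5)"
      by (intro mult_left_mono) (use \<Lambda> in auto)
    then have "norm (\<epsilon> *\<^sub>R cross3 (Ep s - G s) B0) \<le> \<epsilon> * ((\<Lambda> * (norm (z s - y s) + \<epsilon> * A5)) * 1)"
      by (intro norm_scaleR_bound norm_cross3_bound order_trans[OF G[OF s]]) (use \<epsilon> in \<open>auto simp: B0\<close>)
    moreover have "norm (z' s - \<epsilon> *\<^sub>R cross3 (Ep s) B0) \<le> \<epsilon>\<^sup>2 * A4"
      unfolding A4_def by (rule z'_bound[OF s])
    moreover have "z' s - \<epsilon> *\<^sub>R cross3 (G s) B0 =
        (z' s - \<epsilon> *\<^sub>R cross3 (Ep s) B0) + \<epsilon> *\<^sub>R cross3 (Ep s - G s) B0"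
      by (simp add: Cross3.left_diff_distrib algebra_simps)
    ultimately have "norm (z' s - \<epsilon> *\<^sub>R cross3 (G s) B0) \<le> \<epsilon>\<^sup>2 * A4 + \<epsilon> * (\<Lambda> * (norm (z s - y s) + \<epsilon> * A5))"
      by (metis (no_types, lifting) add_mono mult.right_neutral norm_triangle_le)
    \<comment> \<open>Since \<open>\<Lambda>\<close> is at least 1, the drift error fits into the
      affine term \<open>\<epsilon> * ?A\<close> of the inequality.\<close>
    also have "\<epsilon>\<^sup>2 * A4 \<le> \<Lambda> * (\<epsilon>\<^sup>2 * A4)"
      using mult_right_mono[OF \<Lambda>, of "\<epsilon>\<^sup>2 * A4"] A0 by simp
    finally show ?thesis by (simp add: power2_eq_square algebra_simps)
  qed
  from gronwall_norm[OF has_vector_derivative_diff[OF z_deriv y'] this t]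
  have "(norm (z t - y t))\<^sup>2 + (\<epsilon> * ?A)\<^sup>2 \<le> ((norm (z 0 - y 0))\<^sup>2 + (\<epsilon> * ?A)\<^sup>2) * exp (3 * (\<epsilon> * \<Lambda>) * t)"
    using \<epsilon> \<Lambda> by auto
  also have "\<dots> \<le> ((\<epsilon> * ?A)\<^sup>2 + (\<epsilon> * ?A)\<^sup>2) * exp (3 * \<Lambda> * c)"
  proof (intro mult_mono add_mono order_refl)
    have "norm (z 0 - y 0) \<le> \<epsilon> * A5" using zx[of 0] T y0 by simp
    also have "\<dots> \<le> \<epsilon> * ?A" using \<epsilon> A0 by (intro mult_left_mono) auto
    finally show "(norm (z 0 - y 0))\<^sup>2 \<le> (\<epsilon> * ?A)\<^sup>2" by (intro power_mono) auto
    have "\<epsilon> * t \<le> \<epsilon> * T" using t \<epsilon> by (intro mult_left_mono) auto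
    then have "3 * \<Lambda> * (\<epsilon> * t) \<le> 3 * \<Lambda> * c" using c \<Lambda> by (intro mult_left_mono) auto
    then show "exp (3 * (\<epsilon> * \<Lambda>) * t) \<le> exp (3 * \<Lambda> * c)" by (simp add: mult_ac)
  qed auto
  \<comment> \<open>The exponential is at least 1, so the bound is dominated by a perfect square and
    the root can be taken.\<close>
  also have "\<dots> \<le> (2 * (\<epsilon> * ?A) * exp (3 * \<Lambda> * c))\<^sup>2"
  proof -
    have "0 \<le> \<epsilon> * T" using \<epsilon> T by auto
    then have "1 \<le> exp (3 * \<Lambda> * c)" using c \<Lambda> by auto
    moreover have "(X\<^sup>2 + X\<^sup>2) * Y \<le> (2 * X * Y)\<^sup>2" if "1 \<le> Y" for X Y :: real
    proof -
      have "(2 * X\<^sup>2 * Y) * 1 \<le> (2 * X\<^sup>2 * Y) * (2 * Y)" by (intro mult_left_mono) (use that in auto)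
      then show ?thesis by (simp add: power2_eq_square algebra_simps)
    qed
    ultimately show ?thesis by blast
  qed
  finally have "(norm (z t - y t))\<^sup>2 \<le> (2 * (\<epsilon> * ?A) * exp (3 * \<Lambda> * c))\<^sup>2"
    using zero_le_power2[of "\<epsilon> * ?A"] by linarith
  then have "norm (z t - y t) \<le> 2 * (\<epsilon> * ?A) * exp (3 * \<Lambda> * c)"
    by (rule power2_le_imp_le) (use \<epsilon> A0 in auto)
  moreover have "norm (P_perp B0 (x t) - y t) \<le> norm (z t - y t) + \<epsilon> * A5"
    using norm_triangle_ineq4[of "z t - y t" "z t - P_perp B0 (x t)"] zx[OF t] by simp
  moreover have "\<epsilon> * A5 \<le> \<epsilon> * ?A" using \<epsilon> A0 by (intro mult_left_mono) auto
  ultimately show ?thesis unfolding A by (simp add: algebra_simps)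
qed

section \<open>From fields in space to fields along a trajectory\<close>

text \<open>The velocity of the guiding centre \<open>q\<close> is \<open>-\<epsilon> B\<^sub>0 \<times> a\<close> in the perpendicular directions, and a
  function of \<open>q\<^sub>\<perp>\<close> does not see its parallel component.\<close>

lemma guiding_center_field:
  fixes B0 a :: "real^3" and \<epsilon> :: real and x v :: "real \<Rightarrow> real^3"
  defines "q \<equiv> \<lambda>s. x s - \<epsilon> *\<^sub>R cross3 B0 (v s)"
  assumes B0: "norm B0 = 1" and \<epsilon>: "0 < \<epsilon>"
    and F: "smooth_field F" "depends_on_perp B0 F"
    and near: "\<And>p h. norm (p - x t) \<le> \<delta> \<Longrightarrow> norm (iter_deriv F [h] p) \<le> L * norm h"
    and \<delta>: "\<epsilon> * norm (v t) \<le> \<delta>" and L: "0 \<le> L"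
    and x': "(x has_vector_derivative v t) (at t within S)"
    and v': "(v has_vector_derivative ((1/\<epsilon>) *\<^sub>R cross3 (v t) B0 + a)) (at t within S)"
  obtains d where "((\<lambda>s. F (q s)) has_vector_derivative d) (at t within S)"
    and "norm d \<le> L * (\<epsilon> * norm a)"
    and "norm (F (x t) - F (q t)) \<le> L * (\<epsilon> * norm (cross3 B0 (v t)))"
proof -
  define q' where "q' = v t - \<epsilon> *\<^sub>R cross3 B0 ((1/\<epsilon>) *\<^sub>R cross3 (v t) B0 + a)"
  have dq: "(q has_vector_derivative q') (at t within S)"
  proof -
    have "((\<lambda>s. x s - \<epsilon> *\<^sub>R cross3 B0 (v s)) has_vector_derivative
       (v t - \<epsilon> *\<^sub>R (cross3 B0 ((1/\<epsilon>) *\<^sub>R cross3 (v t) B0 + a) + cross3 0 (v t)))) (at t within S)"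
      by (intro has_vector_derivative_diff x' v' has_vector_derivative_cross3 has_vector_derivative_const
        bounded_linear.has_vector_derivative[OF bounded_linear_scaleR_right])
    then show ?thesis by (simp add: q_def q'_def)
  qed
  have nq: "norm (q t - x t) = \<epsilon> * norm (cross3 B0 (v t))"
    using \<epsilon> by (simp add: q_def)
  also have "\<dots> \<le> \<epsilon> * norm (v t)"
    using norm_cross3_le[of B0 "v t"] \<epsilon> B0 by (intro mult_left_mono) auto
  finally have q\<delta>: "norm (q t - x t) \<le> \<delta>" using \<delta> by simp
  have DF: "(F has_derivative (\<lambda>h. iter_deriv F [h] (q t))) (at (q t))"
    using smooth_field_has_derivative[OF F(1), of "[]" "q t"] by simp
  have "((F \<circ> q) has_vector_derivative iter_deriv F [q'] (q t)) (at t within S)"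
    by (rule vector_derivative_diff_chain_within[OF dq has_derivative_at_withinI[OF DF]])
  then have 1: "((\<lambda>s. F (q s)) has_vector_derivative iter_deriv F [q'] (q t)) (at t within S)"
    by (simp only: o_def)
  have "P_perp B0 q' = - (\<epsilon> *\<^sub>R cross3 B0 a)"
  proof -
    have "\<epsilon> *\<^sub>R cross3 B0 ((1/\<epsilon>) *\<^sub>R cross3 (v t) B0 + a) = P_perp B0 (v t) + \<epsilon> *\<^sub>R cross3 B0 a"
      using \<epsilon> by (simp add: cross_add_right cross_mult_right cross3_cross3_unit[OF B0] algebra_simps)
    then have "q' = P_par B0 (v t) - \<epsilon> *\<^sub>R cross3 B0 a" by (simp add: q'_def P_perp_def)
    then show ?thesis
      using B0 by (simp add: P_perp_def P_par_def inner_diff_right dot_cross_self norm_eq_1)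
  qed
  then have "iter_deriv F [q'] (q t) = iter_deriv F [- (\<epsilon> *\<^sub>R cross3 B0 a)] (q t)"
    using depends_on_perp_derivative[OF F(2) B0 DF, of q'] by simp
  then have "norm (iter_deriv F [q'] (q t)) \<le> L * norm (\<epsilon> *\<^sub>R cross3 B0 a)"
    using near[OF q\<delta>, of "- (\<epsilon> *\<^sub>R cross3 B0 a)"] by simp
  also have "\<dots> \<le> L * (\<epsilon> * norm a)"
    using norm_cross3_le[of B0 a] \<epsilon> B0 L by (intro mult_left_mono) auto
  finally have 2: "norm (iter_deriv F [q'] (q t)) \<le> L * (\<epsilon> * norm a)" .
  have "norm (F (q t) - F (x t)) \<le> L * norm (q t - x t)"
    by (rule lipschitz_from_near_bound[OF F(1) near q\<delta>])
  then have 3: "norm (F (x t) - F (q t)) \<le> L * (\<epsilon> * norm (cross3 B0 (v t)))"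
    unfolding nq by (simp add: norm_minus_commute)
  show ?thesis by (rule that[OF 1 2 3])
qed

text \<open>\<open>g\<close> and \<open>f\<close> are \<open>B1\<close> and \<open>Eperp\<close> at
  the guiding centre, which \<open>\<epsilon> * R \<le> \<delta>\<close> keeps in the region around
  \<open>K\<close> where the derivative bounds hold. The constant is \<open>5 * L\<^sup>2\<close>
  because \<open>norm (a t)\<close> is at most \<open>5 * L * (1 + norm (v t))\<close> and the field
  derivative adds a factor \<open>L\<close>.\<close>

lemma gyration_along_trajectory:
  fixes B0 :: "real^3" and B1 B2 Eperp Epar E2 :: "real^3 \<Rightarrow> real^3" and x v :: "real \<Rightarrow> real^3"
  assumes B0: "norm B0 = 1" and \<epsilon>: "0 < \<epsilon>" "\<epsilon> \<le> 1" and L: "1 \<le> L" and R: "1 \<le> R" "\<epsilon> * R\<^sup>2 \<le> 1"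
    and \<delta>: "\<epsilon> * R \<le> \<delta>" and T: "0 \<le> T"
    and F: "smooth_field B1" "depends_on_perp B0 B1" "smooth_field Eperp" "depends_on_perp B0 Eperp"
    and near: "\<And>y p h. y \<in> K \<Longrightarrow> norm (p - y) \<le> \<delta> \<Longrightarrow> norm (iter_deriv B1 [h] p) \<le> L * norm h"
      "\<And>y p h. y \<in> K \<Longrightarrow> norm (p - y) \<le> \<delta> \<Longrightarrow> norm (iter_deriv Eperp [h] p) \<le> L * norm h"
    and le: "\<And>y. y \<in> K \<Longrightarrow> norm (B1 y) \<le> L" "\<And>y. y \<in> K \<Longrightarrow> norm (B2 y) \<le> L"
      "\<And>y. y \<in> K \<Longrightarrow> norm (Eperp y) \<le> L" "\<And>y. y \<in> K \<Longrightarrow> norm (Epar y) \<le> L" "\<And>y. y \<in> K \<Longrightarrow> norm (E2 y) \<le> L"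
    and Epar: "\<And>y. cross3 (Epar y) B0 = 0"
    and xK: "\<And>t. t \<in> {0..T} \<Longrightarrow> x t \<in> K" and K: "\<And>y. y \<in> K \<Longrightarrow> norm y \<le> r"
    and vR: "\<And>t. t \<in> {0..T} \<Longrightarrow> norm (v t) \<le> R"
    and x': "\<And>t. t \<in> {0..T} \<Longrightarrow> (x has_vector_derivative v t) (at t within {0..T})"
    and v': "\<And>t. t \<in> {0..T} \<Longrightarrow> (v has_vector_derivative ((1/\<epsilon>) *\<^sub>R cross3 (v t) B0 +
        (cross3 (v t) (B1 (x t) + \<epsilon> *\<^sub>R B2 (x t)) + (Eperp (x t) + Epar (x t) + \<epsilon> *\<^sub>R E2 (x t))))) (at t within {0..T})"
  obtains g g' f f' where "gyration B0 \<epsilon> (5 * L\<^sup>2) R r T x v g g' f f'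
      (\<lambda>t. B1 (x t)) (\<lambda>t. B2 (x t)) (\<lambda>t. Eperp (x t)) (\<lambda>t. Epar (x t)) (\<lambda>t. E2 (x t))"
proof -
  let ?\<beta> = "5 * L\<^sup>2"
  let ?q = "\<lambda>s. x s - \<epsilon> *\<^sub>R cross3 B0 (v s)"
  have LL: "L \<le> ?\<beta>" "2 * L \<le> ?\<beta>" "1 \<le> ?\<beta>" using L mult_mono[of 1 L 1 L] mult_right_mono[of 1 L L] by (auto simp: power2_eq_square)
  have "\<epsilon> * R \<le> \<epsilon> * R\<^sup>2" using \<epsilon> R(1) by (intro mult_left_mono self_le_power) auto
  then have \<epsilon>R: "\<epsilon> * R \<le> 1" using R(2) by simp
  define a where "a t = cross3 (v t) (B1 (x t) + \<epsilon> *\<^sub>R B2 (x t)) + (Eperp (x t) + Epar (x t) + \<epsilon> *\<^sub>R E2 (x t))" for t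
  have a: "norm (a t) \<le> 5 * L * (1 + norm (v t))" if t: "t \<in> {0..T}" for t
  proof -
    note l = le[OF xK[OF t]]
    have e: "norm (\<epsilon> *\<^sub>R B2 (x t)) \<le> 1 * L" "norm (\<epsilon> *\<^sub>R E2 (x t)) \<le> 1 * L"
      by (intro norm_scaleR_bound l, use \<epsilon> in simp)+
    have "norm (cross3 (v t) (B1 (x t) + \<epsilon> *\<^sub>R B2 (x t))) \<le> norm (v t) * (L + 1 * L)"
      by (intro norm_cross3_bound order_trans[OF norm_triangle_ineq] add_mono l e order_refl)
    moreover have "norm (Eperp (x t) + Epar (x t) + \<epsilon> *\<^sub>R E2 (x t)) \<le> L + L + 1 * L"
      by (intro order_trans[OF norm_triangle_ineq] add_mono l e)
    ultimately have "norm (a t) \<le> norm (v t) * (L + 1 * L) + (L + L + 1 * L)"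
      unfolding a_def by (rule norm_triangle_le[OF add_mono])
    also have "\<dots> \<le> 5 * L * (1 + norm (v t))"
      using L mult_nonneg_nonneg[of L "norm (v t)"] unfolding distrib_left by (simp add: algebra_simps)
    finally show ?thesis .
  qed
  let ?P = "\<lambda>F t d. ((\<lambda>s. F (?q s)) has_vector_derivative d) (at t within {0..T}) \<and>
      norm d \<le> ?\<beta> * (\<epsilon> * (1 + norm (v t))) \<and> norm (F (?q t)) \<le> ?\<beta> \<and>
      norm (F (x t) - F (?q t)) \<le> ?\<beta> * (\<epsilon> * norm (cross3 B0 (v t)))"
  have field: "\<exists>d. ?P F t d"
    if t: "t \<in> {0..T}" and F: "smooth_field F" "depends_on_perp B0 F"
      and near: "\<And>y p h. y \<in> K \<Longrightarrow> norm (p - y) \<le> \<delta> \<Longrightarrow> norm (iter_deriv F [h] p) \<le> L * norm h"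
      and le: "\<And>y. y \<in> K \<Longrightarrow> norm (F y) \<le> L" for F t
  proof -
    have \<epsilon>v: "\<epsilon> * norm (v t) \<le> \<epsilon> * R" using vR[OF t] \<epsilon> by (intro mult_left_mono) auto
    obtain d where d: "((\<lambda>s. F (?q s)) has_vector_derivative d) (at t within {0..T})"
      "norm d \<le> L * (\<epsilon> * norm (a t))"
      "norm (F (x t) - F (?q t)) \<le> L * (\<epsilon> * norm (cross3 B0 (v t)))"
      by (rule guiding_center_field[where t = t and x = x and v = v and F = F and \<delta> = \<delta> and L = L and a = "a t" and S = "{0..T}",
        OF B0 \<epsilon>(1) F near[OF xK[OF t]] order_trans[OF \<epsilon>v \<delta>] _ x'[OF t] v'[OF t, folded a_def]])
        (use L in auto)
    have "L * (\<epsilon> * norm (a t)) \<le> L * (\<epsilon> * (5 * L * (1 + norm (v t))))"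
      by (intro mult_left_mono a t) (use L \<epsilon> in auto)
    with d(2) have 2: "norm d \<le> ?\<beta> * (\<epsilon> * (1 + norm (v t)))" by (simp add: power2_eq_square mult_ac)
    have "L * (\<epsilon> * norm (cross3 B0 (v t))) \<le> ?\<beta> * (\<epsilon> * norm (cross3 B0 (v t)))"
      by (intro mult_right_mono LL) (use \<epsilon> in auto)
    with d(3) have 3: "norm (F (x t) - F (?q t)) \<le> ?\<beta> * (\<epsilon> * norm (cross3 B0 (v t)))" by linarith
    have "\<epsilon> * norm (cross3 B0 (v t)) \<le> \<epsilon> * norm (v t)"
      using norm_cross3_le[of B0 "v t"] \<epsilon> B0 by (intro mult_left_mono) auto
    then have "L * (\<epsilon> * norm (cross3 B0 (v t))) \<le> L * 1" using \<epsilon>v \<epsilon>R L by (intro mult_left_mono) auto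
    then have "norm (F (?q t)) \<le> ?\<beta>"
      using d(3) le[OF xK[OF t]] LL norm_triangle_ineq4[of "F (x t)" "F (x t) - F (?q t)"] by simp
    with d(1) 2 3 show ?thesis by blast
  qed
  have "\<forall>t\<in>{0..T}. \<exists>d. ?P B1 t d" by (intro ballI field F near le)
  from bchoice[OF this] obtain g' where g: "\<And>t. t \<in> {0..T} \<Longrightarrow> ?P B1 t (g' t)" by blast
  have "\<forall>t\<in>{0..T}. \<exists>d. ?P Eperp t d" by (intro ballI field F near le)
  from bchoice[OF this] obtain f' where f: "\<And>t. t \<in> {0..T} \<Longrightarrow> ?P Eperp t (f' t)" by blast
  have "gyration B0 \<epsilon> ?\<beta> R r T x v (\<lambda>s. B1 (?q s)) g' (\<lambda>s. Eperp (?q s)) f'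
      (\<lambda>t. B1 (x t)) (\<lambda>t. B2 (x t)) (\<lambda>t. Eperp (x t)) (\<lambda>t. Epar (x t)) (\<lambda>t. E2 (x t))"
    by unfold_locales (simp_all only: B0 \<epsilon> LL R T x' v' g f K xK vR order_trans[OF le(1) LL(1)] order_trans[OF le(2) LL(1)]
       order_trans[OF le(3) LL(1)] order_trans[OF le(4) LL(1)] order_trans[OF le(5) LL(1)] Epar)
  then show ?thesis by (rule that)
qed

section \<open>Choice of constants and conclusion\<close>

lemma field_bounds:
  assumes "\<And>n. deriv_bounded_on K n (b n) F" and "y \<in> K"
  shows "norm (F y) \<le> \<bar>b 0\<bar>"
  using assms(1)[of 0] assms(2) unfolding deriv_bounded_on_def by fastforce

theorem theorem6p1:
  fixes B0 :: "real^3" and K :: "(real^3) set" and M c :: real and b :: "nat \<Rightarrow> real"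
  assumes "norm B0 = 1" and "compact K" and "c > 0"
  shows "\<exists>C. \<forall>B1 B2 Eperp Epar E2 :: real \<Rightarrow> real^3 \<Rightarrow> real^3.
    admissible_fields B0 B1 B2 Eperp Epar E2 \<and>
    (\<forall>F\<in>{B1, B2, Eperp, Epar, E2}. \<forall>\<epsilon>\<in>{0<..1}. \<forall>n. deriv_bounded_on K n (b n) (F \<epsilon>)) \<longrightarrow>
    (\<exists>\<epsilon>0\<in>{0<..1}. \<forall>\<epsilon>\<in>{0<..\<epsilon>0}. \<forall>x v y.
       charged_particle_solution (magnetic_field B0 B1 B2 \<epsilon>) (electric_field B0 Eperp Epar E2 \<epsilon>)
         (c / \<epsilon>) x v \<and>
       norm (v 0) \<le> M \<and>
       (\<forall>t\<in>{0..c / \<epsilon>}. x t \<in> K) \<and>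
       slow_solution B0 (Eperp \<epsilon>) \<epsilon> (c / \<epsilon>) (P_perp B0 (x 0)) y \<longrightarrow>
       (\<forall>t\<in>{0..c / \<epsilon>}. norm (P_perp B0 (x t) - y t) \<le> C * \<epsilon>))"
proof -
  obtain r where r: "\<And>y. y \<in> K \<Longrightarrow> norm y \<le> r"
    using compact_imp_bounded[OF assms(2)] unfolding bounded_iff by blast
  \<comment> \<open>\<open>L\<close> bounds both the fields on \<open>K\<close> and, through the
    \<open>+ 1\<close>, the first derivatives of \<open>B1\<close> and \<open>Eperp\<close> near
    \<open>K\<close>.\<close>
  define L where "L = \<bar>b 0\<bar> + (\<bar>b 1\<bar> + 1)"
  have L: "1 \<le> L" "\<bar>b 0\<bar> \<le> L" "\<bar>b 1\<bar> + 1 \<le> L" by (auto simp: L_def)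
  define \<beta> where "\<beta> = 5 * L\<^sup>2"
  define W where "W = M + 2 * r + 14 * \<beta>\<^sup>2"
  define V where "V = sqrt ((M\<^sup>2 + 8 * W * \<beta> + 1) * exp (92 * (W * \<beta>)\<^sup>2 * c)) + W"
  \<comment> \<open>\<open>R\<close> strictly exceeds the initial bound \<open>M\<close> and the
    bound \<open>V\<close> of \<open>v_bound\<close>, as the continuity argument requires.\<close>
  define R where "R = max (max 1 M) V + 1"
  have R: "1 \<le> R" "M < R" "V < R" by (auto simp: R_def)
  define D where "D = (\<lambda>\<Lambda>. drift_error \<beta> R r * (1 + 2 * exp (3 * \<Lambda> * c)))"
  \<comment> \<open>The witness \<open>D L\<close> is built from \<open>b 0\<close>,
    \<open>b 1\<close>, \<open>M\<close>, \<open>c\<close> and the radius \<open>r\<close> of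
    \<open>K\<close>, and is fixed before the fields are.\<close>
  show ?thesis
  proof (rule exI[of _ "D L"], intro allI impI)
    fix B1 B2 Eperp Epar E2 :: "real \<Rightarrow> real^3 \<Rightarrow> real^3"
    assume asm: "admissible_fields B0 B1 B2 Eperp Epar E2 \<and>
      (\<forall>F\<in>{B1, B2, Eperp, Epar, E2}. \<forall>\<epsilon>\<in>{0<..1}. \<forall>n. deriv_bounded_on K n (b n) (F \<epsilon>))"
    then have adm: "admissible_fields B0 B1 B2 Eperp Epar E2"
      and bK: "\<And>F \<epsilon> n. F \<in> {B1, B2, Eperp, Epar, E2} \<Longrightarrow> \<epsilon> \<in> {0<..1} \<Longrightarrow> deriv_bounded_on K n (b n) (F \<epsilon>)"
      by blast+
    have fam: "smooth_bounded_family B1" "smooth_bounded_family Eperp"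
      and dep: "\<And>\<epsilon>. \<epsilon> \<in> {0<..1} \<Longrightarrow> depends_on_perp B0 (B1 \<epsilon>)" "\<And>\<epsilon>. \<epsilon> \<in> {0<..1} \<Longrightarrow> depends_on_perp B0 (Eperp \<epsilon>)"
      and par: "\<And>\<epsilon> y. \<epsilon> \<in> {0<..1} \<Longrightarrow> cross3 (Epar \<epsilon> y) B0 = 0"
      using adm unfolding admissible_fields_def by blast+
    have sm: "\<And>\<epsilon>. \<epsilon> \<in> {0<..1} \<Longrightarrow> smooth_field (B1 \<epsilon>)" "\<And>\<epsilon>. \<epsilon> \<in> {0<..1} \<Longrightarrow> smooth_field (Eperp \<epsilon>)"
      using fam unfolding smooth_bounded_family_def by blast+
    obtain \<delta>1 where \<delta>1: "\<delta>1 > 0" "\<And>\<epsilon> x p h. \<epsilon> \<in> {0<..1} \<Longrightarrow> x \<in> K \<Longrightarrow> norm (p - x) \<le> \<delta>1 \<Longrightarrow>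
       norm (iter_deriv (B1 \<epsilon>) [h] p) \<le> (\<bar>b 1\<bar> + 1) * norm h"
      using smooth_bounded_family_near[OF fam(1) bK[of B1]] by (metis insertI1)
    obtain \<delta>2 where \<delta>2: "\<delta>2 > 0" "\<And>\<epsilon> x p h. \<epsilon> \<in> {0<..1} \<Longrightarrow> x \<in> K \<Longrightarrow> norm (p - x) \<le> \<delta>2 \<Longrightarrow>
       norm (iter_deriv (Eperp \<epsilon>) [h] p) \<le> (\<bar>b 1\<bar> + 1) * norm h"
      using smooth_bounded_family_near[OF fam(2) bK[of Eperp]] by (metis insertCI)
    obtain \<Lambda> where \<Lambda>: "1 \<le> \<Lambda>" "\<And>\<epsilon> x y. \<epsilon> \<in> {0<..1} \<Longrightarrow> norm (Eperp \<epsilon> x - Eperp \<epsilon> y) \<le> \<Lambda> * norm (x - y)"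
      using smooth_bounded_family_lipschitz[OF fam(2)] by metis
    define \<delta> where "\<delta> = min \<delta>1 \<delta>2"
    have \<delta>: "0 < \<delta>" "\<delta> \<le> \<delta>1" "\<delta> \<le> \<delta>2" using \<delta>1(1) \<delta>2(1) by (auto simp: \<delta>_def)
    have near: "norm (iter_deriv (B1 \<epsilon>) [h] p) \<le> L * norm h" "norm (iter_deriv (Eperp \<epsilon>) [h] p) \<le> L * norm h"
      if "\<epsilon> \<in> {0<..1}" "y \<in> K" "norm (p - y) \<le> \<delta>" for \<epsilon> y p h
      using order_trans[OF \<delta>1(2)[OF that(1,2)] mult_right_mono[OF L(3) norm_ge_zero]]
        order_trans[OF \<delta>2(2)[OF that(1,2)] mult_right_mono[OF L(3) norm_ge_zero]] that(3) \<delta> by auto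
    have bd: "norm (F \<epsilon> y) \<le> L" if "F \<in> {B1, B2, Eperp, Epar, E2}" "\<epsilon> \<in> {0<..1}" "y \<in> K" for F \<epsilon> y
      by (rule order_trans[OF field_bounds[OF bK[OF that(1,2)] that(3)] L(2)])
    \<comment> \<open>Beyond 1, the entries ensure in turn
      \<open>\<epsilon> * R\<^sup>2 \<le> 1\<close>, a guiding centre within \<open>\<delta>\<close>
      of \<open>K\<close>, and a preliminary error below \<open>\<delta>\<close>. Global bounds
      enter only here, through \<open>\<delta>\<close> and \<open>\<Lambda>\<close>.\<close>
    define \<epsilon>0 where "\<epsilon>0 = min (min 1 (1 / R\<^sup>2)) (min (\<delta> / R) (\<delta> / (\<bar>D \<Lambda>\<bar> + 1)))"
    have "\<epsilon>0 \<le> 1" unfolding \<epsilon>0_def by (rule min.coboundedI1[OF min.cobounded1])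
    moreover have "0 < \<epsilon>0" using R \<delta> by (simp add: \<epsilon>0_def add_nonneg_pos)
    ultimately have \<epsilon>0: "\<epsilon>0 \<in> {0<..1}" by simp
    show "\<exists>\<epsilon>0\<in>{0<..1}. \<forall>\<epsilon>\<in>{0<..\<epsilon>0}. \<forall>x v y.
       charged_particle_solution (magnetic_field B0 B1 B2 \<epsilon>) (electric_field B0 Eperp Epar E2 \<epsilon>)
         (c / \<epsilon>) x v \<and>
       norm (v 0) \<le> M \<and>
       (\<forall>t\<in>{0..c / \<epsilon>}. x t \<in> K) \<and>
       slow_solution B0 (Eperp \<epsilon>) \<epsilon> (c / \<epsilon>) (P_perp B0 (x 0)) y \<longrightarrow>
       (\<forall>t\<in>{0..c / \<epsilon>}. norm (P_perp B0 (x t) - y t) \<le> D L * \<epsilon>)"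
    proof (rule bexI[OF _ \<epsilon>0], intro ballI allI impI)
      fix \<epsilon> x v y t
      assume \<epsilon>: "\<epsilon> \<in> {0<..\<epsilon>0}" and t: "t \<in> {0..c / \<epsilon>}"
        and sol: "charged_particle_solution (magnetic_field B0 B1 B2 \<epsilon>) (electric_field B0 Eperp Epar E2 \<epsilon>)
           (c / \<epsilon>) x v \<and> norm (v 0) \<le> M \<and> (\<forall>t\<in>{0..c / \<epsilon>}. x t \<in> K) \<and>
           slow_solution B0 (Eperp \<epsilon>) \<epsilon> (c / \<epsilon>) (P_perp B0 (x 0)) y"
      define T where "T = c / \<epsilon>"
      have e: "\<epsilon> \<in> {0<..1}" "0 < \<epsilon>" "\<epsilon> \<le> 1" using \<epsilon> \<epsilon>0 by auto
      have T: "0 \<le> T" and \<epsilon>T: "\<epsilon> * T = c" using e assms(3) by (auto simp: T_def)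
      have "\<epsilon> \<le> 1 / R\<^sup>2" "\<epsilon> \<le> \<delta> / R" "\<epsilon> \<le> \<delta> / (\<bar>D \<Lambda>\<bar> + 1)" using \<epsilon> by (auto simp: \<epsilon>0_def)
      then have small: "\<epsilon> * R\<^sup>2 \<le> 1" "\<epsilon> * R \<le> \<delta>" "\<epsilon> * (\<bar>D \<Lambda>\<bar> + 1) \<le> \<delta>"
        using R(1) by (simp_all add: pos_le_divide_eq add_nonneg_pos)
      have x': "\<And>s. s \<in> {0..T} \<Longrightarrow> (x has_vector_derivative v s) (at s within {0..T})"
        and v': "\<And>s. s \<in> {0..T} \<Longrightarrow> (v has_vector_derivative (cross3 (v s) (magnetic_field B0 B1 B2 \<epsilon> (x s))
            + electric_field B0 Eperp Epar E2 \<epsilon> (x s))) (at s within {0..T})"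
        and y': "\<And>s. s \<in> {0..T} \<Longrightarrow> (y has_vector_derivative (\<epsilon> *\<^sub>R cross3 (Eperp \<epsilon> (y s)) B0)) (at s within {0..T})"
        and y0: "y 0 = P_perp B0 (x 0)" and xK: "\<And>s. s \<in> {0..T} \<Longrightarrow> x s \<in> K" and M: "norm (v 0) \<le> M"
        using sol unfolding charged_particle_solution_def slow_solution_def T_def by blast+
      have pp: "B1 \<epsilon> (P_perp B0 p) = B1 \<epsilon> p" "Eperp \<epsilon> (P_perp B0 p) = Eperp \<epsilon> p" for p
        using dep[OF e(1)] P_perp_idem[OF assms(1)] unfolding depends_on_perp_def by blast+
      have v'': "(v has_vector_derivative ((1/\<epsilon>) *\<^sub>R cross3 (v s) B0 +
          (cross3 (v s) (B1 \<epsilon> (x s) + \<epsilon> *\<^sub>R B2 \<epsilon> (x s)) + (Eperp \<epsilon> (x s) + Epar \<epsilon> (x s) + \<epsilon> *\<^sub>R E2 \<epsilon> (x s)))))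
          (at s within {0..T})" if "s \<in> {0..T}" for s
        using v'[OF that] unfolding magnetic_field_def electric_field_def pp
        by (simp add: cross_add_right cross_mult_right add.assoc)
      \<comment> \<open>Initial intervals \<open>{0..S}\<close> are allowed because the continuity
        argument needs the estimates before the speed bound is known up to \<open>T\<close>.\<close>
      have gyr: "\<exists>g g' f f'. gyration B0 \<epsilon> \<beta> R r S x v g g' f f' (\<lambda>t. B1 \<epsilon> (x t)) (\<lambda>t. B2 \<epsilon> (x t))
          (\<lambda>t. Eperp \<epsilon> (x t)) (\<lambda>t. Epar \<epsilon> (x t)) (\<lambda>t. E2 \<epsilon> (x t))"
        if S: "S \<in> {0..T}" and vR: "\<And>s. s \<in> {0..S} \<Longrightarrow> norm (v s) \<le> R" for S
      proof -
        have sub: "s \<in> {0..T}" if "s \<in> {0..S}" for s using that S by auto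
        have subset: "{0..S} \<subseteq> {0..T}" using S by auto
        have bd': "z \<in> K \<Longrightarrow> norm (B1 \<epsilon> z) \<le> L" "z \<in> K \<Longrightarrow> norm (B2 \<epsilon> z) \<le> L" "z \<in> K \<Longrightarrow> norm (Eperp \<epsilon> z) \<le> L"
          "z \<in> K \<Longrightarrow> norm (Epar \<epsilon> z) \<le> L" "z \<in> K \<Longrightarrow> norm (E2 \<epsilon> z) \<le> L" for z
          by (rule bd[OF _ e(1)]; simp)+
        have S0: "0 \<le> S" using S by auto
        show ?thesis
          by (rule gyration_along_trajectory[where L = L and R = R and T = S and K = K and r = r and x = x and v = v
              and ?B1.0 = "B1 \<epsilon>" and ?B2.0 = "B2 \<epsilon>" and Eperp = "Eperp \<epsilon>" and Epar = "Epar \<epsilon>" and ?E2.0 = "E2 \<epsilon>",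
              OF assms(1) e(2,3) L(1) R(1) small(1,2) S0 sm(1)[OF e(1)] dep(1)[OF e(1)] sm(2)[OF e(1)] dep(2)[OF e(1)]
              near[OF e(1)] bd' par[OF e(1)] xK[OF sub] r vR has_vector_derivative_within_subset[OF x'[OF sub] subset]
              has_vector_derivative_within_subset[OF v''[OF sub] subset]])
            (assumption+, unfold \<beta>_def, intro exI, assumption)
      qed
      have vR: "norm (v s) < R" if "s \<in> {0..T}" for s
      proof (rule continuous_bootstrap[where \<phi> = "\<lambda>s. norm (v s)", OF _ _ _ that])
        show "continuous_on {0..T} (\<lambda>s. norm (v s))"
          using has_vector_derivative_continuous[OF v'']
          by (intro continuous_on_norm) (auto simp: continuous_on_eq_continuous_within)
        show "norm (v 0) < R" using M R by simp
        fix S assume S: "S \<in> {0..T}" and le: "\<And>s. s \<in> {0..S} \<Longrightarrow> norm (v s) \<le> R"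
        from gyr[OF this] obtain g g' f f' where G: "gyration B0 \<epsilon> \<beta> R r S x v g g' f f' (\<lambda>t. B1 \<epsilon> (x t)) (\<lambda>t. B2 \<epsilon> (x t))
          (\<lambda>t. Eperp \<epsilon> (x t)) (\<lambda>t. Epar \<epsilon> (x t)) (\<lambda>t. E2 \<epsilon> (x t))" by blast
        have "\<epsilon> * S \<le> \<epsilon> * T" using S e by (intro mult_left_mono) auto
        then have "norm (v S) \<le> V"
          unfolding V_def by (intro gyration.v_bound[OF G _ M]) (use S \<epsilon>T W_def in auto)
        then show "norm (v S) < R" using R by simp
      qed
      from gyr[of T] vR T obtain g g' f f' where "gyration B0 \<epsilon> \<beta> R r T x v g g' f f' (\<lambda>t. B1 \<epsilon> (x t)) (\<lambda>t. B2 \<epsilon> (x t))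
          (\<lambda>t. Eperp \<epsilon> (x t)) (\<lambda>t. Epar \<epsilon> (x t)) (\<lambda>t. E2 \<epsilon> (x t))" by (force simp: less_imp_le)
      then interpret gyration B0 \<epsilon> \<beta> R r T x v g g' f f' "\<lambda>t. B1 \<epsilon> (x t)" "\<lambda>t. B2 \<epsilon> (x t)"
          "\<lambda>t. Eperp \<epsilon> (x t)" "\<lambda>t. Epar \<epsilon> (x t)" "\<lambda>t. E2 \<epsilon> (x t)" .
      \<comment> \<open>\<open>y s\<close> itself need not be near \<open>K\<close>. The shifted
        point has the same perpendicular component and differs from \<open>x s\<close> in
        \<open>K\<close> only by the error to be estimated.\<close>
      have Ty: "Eperp \<epsilon> (y s) = Eperp \<epsilon> (x s + (y s - P_perp B0 (x s)))" for s
        using dep(2)[OF e(1)] P_perp_idem[OF assms(1)] unfolding depends_on_perp_def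
        by (metis (no_types, lifting) P_perp_add P_perp_diff add_diff_cancel_left' diff_add_cancel add.commute)
      \<comment> \<open>First comparison, with the global constant \<open>\<Lambda>\<close>: it only
        serves to bring the shifted point within \<open>\<delta>\<close> of
        \<open>K\<close>.\<close>
      have near_y: "norm (P_perp B0 (x s) - y s) \<le> \<delta>" if s: "s \<in> {0..T}" for s
      proof -
        have "norm (P_perp B0 (x s) - y s) \<le> D \<Lambda> * \<epsilon>" unfolding D_def
        proof (rule slow_close[OF y0 y' \<Lambda>(1) _ _ s])
          show "norm (Eperp \<epsilon> (x q) - Eperp \<epsilon> (y q)) \<le> \<Lambda> * norm (P_perp B0 (x q) - y q)" for q
            using \<Lambda>(2)[OF e(1), of "P_perp B0 (x q)" "y q"] by (simp add: pp)
        qed (use \<epsilon>T in auto)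
        also have "\<dots> \<le> (\<bar>D \<Lambda>\<bar> + 1) * \<epsilon>" using e by (intro mult_right_mono) auto
        finally show ?thesis using small(3) by (simp add: mult.commute)
      qed
      \<comment> \<open>Second comparison: near \<open>K\<close> the Lipschitz constant
        \<open>L\<close> is available, which yields the final constant.\<close>
      show "norm (P_perp B0 (x t) - y t) \<le> D L * \<epsilon>" unfolding D_def
      proof (rule slow_close[OF y0 y' L(1)])
        fix q assume q: "q \<in> {0..T}"
        have "norm (Eperp \<epsilon> (x q + (y q - P_perp B0 (x q))) - Eperp \<epsilon> (x q)) \<le>
            L * norm ((x q + (y q - P_perp B0 (x q))) - x q)"
          by (rule lipschitz_from_near_bound[OF sm(2)[OF e(1)] near(2)[OF e(1) xK[OF q]]])
            (use near_y[OF q] in \<open>simp_all add: norm_minus_commute\<close>)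
        then show "norm (Eperp \<epsilon> (x q) - Eperp \<epsilon> (y q)) \<le> L * norm (P_perp B0 (x q) - y q)"
          by (simp add: Ty[symmetric] norm_minus_commute)
      qed (use \<epsilon>T t T_def in auto)
    qed
  qed
qed

end
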